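(* Let $r_0>0$, $E>0$, let $\ell\ge2$ and $m\ge1$ be integers with $m\neq\ell$, let $\Omega=\{x\in\mathbb{R}^2:|x|<r_0\}$, and let $(u_\omega,u_{2\omega})$ solve the second harmonic generation system on $\Omega$ (defined in the context) with background field, in polar coordinates, $H=-E\left(r^m\cos(m\theta)+r^\ell\cos(\ell\theta)\right)$. Let $d_{\mathrm{rel}}=|m-\ell|$ be the relative symmetry degree. If $d_{\mathrm{rel}}=1$, then dipole radiation occurs. Furthermore, if $d_{\mathrm{rel}}=n$, then $2^n$-multipole radiation occurs. Additionally, the resonant behavior of both dipole and multipole radiation is as follows: (a) if $\varepsilon_\omega=-1$ and $\varepsilon_{2\omega}\neq-1$, then the resonance order is $O\left((1+\varepsilon_\omega)^{-2}\right)$; (b) if $\varepsilon_\omega\neq-1$ and $\varepsilon_{2\omega}=-1$, then the resonance order is $O\left((1+\varepsilon_{2\omega})^{-1}\right)$; (c) if $\varepsilon_\omega=-1$ and $\varepsilon_{2\omega}=-1$, then the resonance order is $O\left((1+\varepsilon_\omega)^{-2}(1+\varepsilon_{2\omega})^{-1}\right)$.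
   Context: Second harmonic generation system on a bounded domain $D\subset\mathbb{R}^2$ with background $H$ (a harmonic function in $\mathbb{R}^2$): let $\varepsilon_\omega,\varepsilon_{2\omega}$ (permittivities) and $\chi_\perp^s,\chi_\parallel^s$ (surface susceptibilities) be constants. Let $\nu$ be the outward unit normal and $T$ the unit tangent on $\partial D$; subscripts $+$ and $-$ denote limits from outside and inside $D$. The pair $(u_\omega,u_{2\omega})$ (fundamental field, second-harmonic field) satisfies: $\Delta u_\omega=\Delta u_{2\omega}=0$ in $\mathbb{R}^2\setminus\partial D$; on $\partial D$, $u_\omega|_+=u_\omega|_-$, $\partial_\nu u_\omega|_+=\varepsilon_\omega\partial_\nu u_\omega|_-$, $u_{2\omega}|_+-u_{2\omega}|_-=4\pi P_\perp^s$, $\partial_\nu u_{2\omega}|_+-\varepsilon_{2\omega}\partial_\nu u_{2\omega}|_-=-4\pi\sigma^s$; and $u_\omega=H(x)+O(|x|^{-1})$, $u_{2\omega}=o(1)$ as $|x|\to\infty$. Here $$P_\perp^s=\chi_\perp^s\left(\varepsilon_\omega\partial_\nu u_\omega|_-\right)^2,\quad P_\parallel^s=2\chi_\parallel^s\left(\varepsilon_\omega\partial_\nu u_\omega|_-\right)\left(\partial_Tu_\omega|_-\right),\quad \sigma^s=-\partial_TP_\parallel^s,$$ where $\partial_T$ of a function on the boundary is the derivative with respect to arclength. A solution $u_{2\omega}$ of the Laplace equation whose domain of definition contains the exterior of some circle is called dipole radiation if $u_{2\omega}=O(1/|x|)$ as $|x|\to\infty$, uniformly in all directions; more generally, the second-harmonic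 field is called a $2^n$-multipole radiation field if $u_{2\omega}=O(1/|x|^n)$ as $|x|\to\infty$. The resonance order is the order of magnitude of the radiated second harmonic field as the permittivities approach the resonant values; "$\varepsilon_\omega=-1$" and "$\varepsilon_{2\omega}=-1$" are understood as limits $\varepsilon_\omega\to-1$, $\varepsilon_{2\omega}\to-1$.
   Formalization: The 2^n-multipole claim assumes ε_2ω≠-1 and holds for the full field only if n ≤ 2 min(m,ℓ), since the self-interaction modes 2m, 2ℓ break it otherwise; for all m,ℓ it is stated for u_2ω minus the second-harmonic fields of each single mode. *)

theory Defs
  imports "HOL-Analysis.Analysis" "HOL-Library.Landau_Symbols"
begin

(* The plane is the type complex, a point (x1, x2) being x1 + i x2. Permittivities,
   susceptibilities and fields take complex values; real data are the special case. *)

section \<open>Harmonic functions\<close>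

definition ddir :: "complex \<Rightarrow> (complex \<Rightarrow> complex) \<Rightarrow> complex \<Rightarrow> complex" where
  "ddir w u x = frechet_derivative u (at x) w"

definition laplacian :: "(complex \<Rightarrow> complex) \<Rightarrow> complex \<Rightarrow> complex" where
  "laplacian u x = ddir 1 (ddir 1 u) x + ddir \<i> (ddir \<i> u) x"

definition harmonic_on :: "complex set \<Rightarrow> (complex \<Rightarrow> complex) \<Rightarrow> bool" where
  "harmonic_on S u \<longleftrightarrow> open S \<and> u differentiable_on S \<and>
     (\<forall>v\<in>{1, \<i>}. ddir v u differentiable_on S) \<and>
     (\<forall>v\<in>{1, \<i>}. \<forall>w\<in>{1, \<i>}. continuous_on S (ddir w (ddir v u))) \<and>
     (\<forall>x\<in>S. laplacian u x = 0)"

section \<open>One-sided boundary values\<close>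

(* A is the side from which the boundary is approached: D itself for the subscript -,
   and - closure D for the subscript +. All limits are unrestricted within A. *)

definition bval :: "complex set \<Rightarrow> (complex \<Rightarrow> complex) \<Rightarrow> complex \<Rightarrow> complex" where
  "bval A u x = Lim (at x within A) u"

definition bderiv :: "complex set \<Rightarrow> complex \<Rightarrow> (complex \<Rightarrow> complex) \<Rightarrow> complex \<Rightarrow> complex" where
  "bderiv A w u x = Lim (at x within A) (ddir w u)"

(* Existence of the limits above: u and its first partial derivatives extend
   continuously to the boundary from the side A. *)
definition C1_up_to :: "complex set \<Rightarrow> complex set \<Rightarrow> (complex \<Rightarrow> complex) \<Rightarrow> bool" where
  "C1_up_to A B u \<longleftrightarrow> (\<forall>x\<in>B. (\<exists>L. (u \<longlongrightarrow> L) (at x within A)) \<and>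
     (\<forall>w\<in>{1, \<i>}. \<exists>L. (ddir w u \<longlongrightarrow> L) (at x within A)))"

section \<open>The second harmonic generation system\<close>

(* The boundary of D is described by an arclength parametrisation g with D on its left.
   Hence the unit tangent at g s is g' s, the outward unit normal is - i g' s, and the
   derivative with respect to arclength of a function f on the boundary, at g s, is
   (f o g)' s. Quantities living on the boundary are functions of s. *)

definition unit_tangent :: "(real \<Rightarrow> complex) \<Rightarrow> real \<Rightarrow> complex" where
  "unit_tangent g s = vector_derivative g (at s)"

definition outward_normal :: "(real \<Rightarrow> complex) \<Rightarrow> real \<Rightarrow> complex" where
  "outward_normal g s = - \<i> * unit_tangent g s"

definition normal_deriv ::
  "complex set \<Rightarrow> (real \<Rightarrow> complex) \<Rightarrow> (complex \<Rightarrow> complex) \<Rightarrow> real \<Rightarrow> complex" where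
  "normal_deriv A g u s = bderiv A (outward_normal g s) u (g s)"

definition P_perp ::
  "complex set \<Rightarrow> (real \<Rightarrow> complex) \<Rightarrow> complex \<Rightarrow> complex \<Rightarrow> (complex \<Rightarrow> complex) \<Rightarrow> real \<Rightarrow> complex"
  where "P_perp D g chi_perp eps u s = chi_perp * (eps * normal_deriv D g u s)\<^sup>2"

definition P_par ::
  "complex set \<Rightarrow> (real \<Rightarrow> complex) \<Rightarrow> complex \<Rightarrow> complex \<Rightarrow> (complex \<Rightarrow> complex) \<Rightarrow> real \<Rightarrow> complex"
  where "P_par D g chi_par eps u s = 2 * chi_par * (eps * normal_deriv D g u s) *
           vector_derivative (\<lambda>t. bval D u (g t)) (at s)"

definition surface_charge ::
  "complex set \<Rightarrow> (real \<Rightarrow> complex) \<Rightarrow> complex \<Rightarrow> complex \<Rightarrow> (complex \<Rightarrow> complex) \<Rightarrow> real \<Rightarrow> complex"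
  where "surface_charge D g chi_par eps u s =
           - vector_derivative (P_par D g chi_par eps u) (at s)"

(* u is the fundamental field, v the second-harmonic field. *)
definition shg_solution ::
  "complex set \<Rightarrow> (real \<Rightarrow> complex) \<Rightarrow> complex \<Rightarrow> complex \<Rightarrow> (complex \<Rightarrow> complex) \<Rightarrow>
   complex \<Rightarrow> complex \<Rightarrow> (complex \<Rightarrow> complex) \<Rightarrow> (complex \<Rightarrow> complex) \<Rightarrow> bool" where
  "shg_solution D g chi_perp chi_par H eps1 eps2 u v \<longleftrightarrow>
     (let Ex = - closure D in
      harmonic_on (- frontier D) u \<and> harmonic_on (- frontier D) v \<and>
      C1_up_to D (frontier D) u \<and> C1_up_to Ex (frontier D) u \<and>
      C1_up_to D (frontier D) v \<and> C1_up_to Ex (frontier D) v \<and>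
      (\<forall>s. (\<lambda>t. bval D u (g t)) differentiable (at s)) \<and>
      (\<forall>s. P_par D g chi_par eps1 u differentiable (at s)) \<and>
      (\<forall>s. bval Ex u (g s) = bval D u (g s)) \<and>
      (\<forall>s. normal_deriv Ex g u s = eps1 * normal_deriv D g u s) \<and>
      (\<forall>s. bval Ex v (g s) - bval D v (g s) = 4 * pi * P_perp D g chi_perp eps1 u s) \<and>
      (\<forall>s. normal_deriv Ex g v s - eps2 * normal_deriv D g v s
             = - 4 * pi * surface_charge D g chi_par eps1 u s) \<and>
      (\<lambda>x. u x - H x) \<in> O[at_infinity](\<lambda>x. complex_of_real (1 / norm x)) \<and>
      v \<in> o[at_infinity](\<lambda>_. 1))"

definition circle_arclength :: "real \<Rightarrow> real \<Rightarrow> complex" where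
  "circle_arclength r0 s = complex_of_real r0 * cis (s / r0)"

definition disk_shg_solution ::
  "real \<Rightarrow> complex \<Rightarrow> complex \<Rightarrow> (complex \<Rightarrow> complex) \<Rightarrow>
   complex \<Rightarrow> complex \<Rightarrow> (complex \<Rightarrow> complex) \<Rightarrow> (complex \<Rightarrow> complex) \<Rightarrow> bool" where
  "disk_shg_solution r0 = shg_solution (ball 0 r0) (circle_arclength r0)"

definition mode_field :: "real \<Rightarrow> nat \<Rightarrow> complex \<Rightarrow> complex" where
  "mode_field E k x = complex_of_real (- E * (norm x ^ k * cos (real k * Arg x)))"

definition two_mode_field :: "real \<Rightarrow> nat \<Rightarrow> nat \<Rightarrow> complex \<Rightarrow> complex" where
  "two_mode_field E m l x = complex_of_real
     (- E * (norm x ^ m * cos (real m * Arg x) + norm x ^ l * cos (real l * Arg x)))"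

definition rel_sym_degree :: "nat \<Rightarrow> nat \<Rightarrow> nat" where
  "rel_sym_degree m l = nat \<bar>int m - int l\<bar>"

section \<open>Radiation and resonance\<close>

(* Says that u is a 2^n-multipole radiation field. The filter at_infinity makes the
   bound uniform in all directions. *)
definition multipole_radiation :: "nat \<Rightarrow> (complex \<Rightarrow> complex) \<Rightarrow> bool" where
  "multipole_radiation n u \<longleftrightarrow> (\<exists>R. harmonic_on {x. R < norm x} u) \<and>
     u \<in> O[at_infinity](\<lambda>x. complex_of_real (1 / norm x ^ n))"

definition dipole_radiation :: "(complex \<Rightarrow> complex) \<Rightarrow> bool" where
  "dipole_radiation u \<longleftrightarrow> (\<exists>R. harmonic_on {x. R < norm x} u) \<and>
     u \<in> O[at_infinity](\<lambda>x. complex_of_real (1 / norm x))"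

definition second_harmonic_fields ::
  "real \<Rightarrow> complex \<Rightarrow> complex \<Rightarrow> (complex \<Rightarrow> complex) \<Rightarrow>
   complex \<Rightarrow> complex \<Rightarrow> (complex \<Rightarrow> complex) set" where
  "second_harmonic_fields r0 chi_perp chi_par H eps1 eps2 =
     {v. \<exists>u. disk_shg_solution r0 chi_perp chi_par H eps1 eps2 u v}"

(* V p is the set of second-harmonic fields for the parameter p, and F describes how p
   approaches its resonant value. The magnitude of a field is its supremum norm over
   the region A where it is radiated, so one constant serves all points of A. *)
definition resonance_order ::
  "complex set \<Rightarrow> 'p filter \<Rightarrow> ('p \<Rightarrow> (complex \<Rightarrow> complex) set) \<Rightarrow> ('p \<Rightarrow> complex) \<Rightarrow> bool" where
  "resonance_order A F V f \<longleftrightarrow>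
     (\<exists>C. \<forall>\<^sub>F p in F. \<forall>v\<in>V p. \<forall>x\<in>A. norm (v x) \<le> C * norm (f p))"

end

theory Submission
  imports Defs "HOL-Complex_Analysis.Complex_Analysis"
begin

text \<open>On the disk of radius r the reflection x -> r^2 / cnj x carries interior harmonic functions
  to exterior ones and reverses the normal derivative on the circle. For a field with prescribed
  trigonometric jumps of its value and of its flux, the exterior field minus the reflected interior
  field minus an explicit sum of modes vanishes on the circle and is bounded, hence vanishes by the
  maximum principle. The flux condition then becomes a Neumann condition for the interior field
  alone, multiplied by 1 + eps, and the radial derivative x . grad u of a harmonic u is harmonic, so
  it determines (1 + eps) u up to a constant. Applied to the fundamental field this yields the factor
  1 / (1 + eps1) (and excludes eps1 = -1). The sources of the second-harmonic field are quadratic in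
  it and have only the modes 2m, 2l, m + l, |m - l|; the first two are also generated by each
  background mode alone.\<close>

section \<open>Harmonic functions as local real parts and the maximum principle\<close>

text \<open>A solution is known only through its equations and its one-sided limits. No Fourier
  expansion of the fields is made; the only modes that occur are the finitely many in the data, and
  everything else is uniqueness. The value -1 is resonant because, up to modes of the data, the
  outer flux is minus the inner flux, so that \<open>outer - eps * inner\<close> collapses to
  \<open>-(1 + eps) * inner\<close>. The factor 1 + eps1 is squared because both surface sources
  contain two derivatives of the fundamental field, while 1 + eps2 occurs once, from the last
  transmission problem. The difference frequency |m - l| comes from the normal polarisation alone:
  in the tangential one the cross terms combine to the sum frequency. At eps2 = -1 the identity for
  (1 + eps2) v says nothing about v; dipole decay does not pass through it, but through the
  differentiability of the interior field at the centre, transported to infinity by the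
  reflection.\<close>

lemma mvt_direction:
  fixes g :: "complex \<Rightarrow> real"
  assumes "t > 0" and D: "\<And>s. 0 \<le> s \<Longrightarrow> s \<le> t \<Longrightarrow> (g has_derivative G (z + s *\<^sub>R w)) (at (z + s *\<^sub>R w))"
  obtains s where "0 < s" "s < t" "g (z + t *\<^sub>R w) - g z = t * G (z + s *\<^sub>R w) w"
proof -
  have "((\<lambda>s. g (z + s *\<^sub>R w)) has_real_derivative G (z + s *\<^sub>R w) w) (at s)" if "0 \<le> s" "s \<le> t" for s
  proof -
    have "((\<lambda>s. z + s *\<^sub>R w) has_derivative (\<lambda>h. h *\<^sub>R w)) (at s)"
      by (auto intro!: derivative_eq_intros)
    from has_derivative_compose[OF this D[OF that]]
    have "((\<lambda>s. g (z + s *\<^sub>R w)) has_derivative (\<lambda>h. G (z + s *\<^sub>R w) (h *\<^sub>R w))) (at s)" .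
    moreover have "(\<lambda>h. G (z + s *\<^sub>R w) (h *\<^sub>R w)) = (*) (G (z + s *\<^sub>R w) w)"
      using has_derivative_bounded_linear[OF D[OF that]]
      by (auto simp: linear_simps)
    ultimately show ?thesis by (simp add: has_field_derivative_def)
  qed
  from MVT2[OF \<open>t > 0\<close>, of "\<lambda>s. g (z + s *\<^sub>R w)", OF this]
  show ?thesis using that by auto
qed

text \<open>The second difference of \<open>a\<close> over a square of side t, computed by the mean
  value theorem in either order, is t^2 times one or the other mixed derivative at a nearby point;
  then t tends to 0. The Cauchy-Riemann equations for \<open>p - i q\<close> require this equality,
  and \<open>harmonic_on\<close> asserts only that both mixed derivatives are continuous.\<close>

lemma mixed_partials_eq:
  fixes a p q :: "complex \<Rightarrow> real"
  assumes S: "open S" "z \<in> S"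
    and a: "\<And>x. x \<in> S \<Longrightarrow> (a has_derivative (\<lambda>h. p x * Re h + q x * Im h)) (at x)"
    and p: "\<And>x. x \<in> S \<Longrightarrow> (p has_derivative p' x) (at x)"
    and q: "\<And>x. x \<in> S \<Longrightarrow> (q has_derivative q' x) (at x)"
    and cp: "continuous_on S (\<lambda>x. p' x \<i>)" and cq: "continuous_on S (\<lambda>x. q' x 1)"
  shows "p' z \<i> = q' z 1"
proof -
  obtain r where r: "r > 0" "ball z r \<subseteq> S" using S openE by blast
  \<comment> \<open>The sample points are z + s + s' i with 0 < s, s' < t, hence the radius 2
    t.\<close>
  have mixed: "\<exists>x y. dist x z < 2 * t \<and> dist y z < 2 * t \<and> p' x \<i> = q' y 1"
    if t: "0 < t" "2 * t < r" for t
  proof -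
    have inS: "z + s *\<^sub>R 1 + s' *\<^sub>R \<i> \<in> S" "dist (z + s *\<^sub>R 1 + s' *\<^sub>R \<i>) z \<le> s + s'"
      if "0 \<le> s" "s \<le> t" "0 \<le> s'" "s' \<le> t" for s s'
    proof -
      have "norm (s *\<^sub>R 1 + s' *\<^sub>R \<i>) \<le> s + s'"
        using norm_triangle_ineq[of "s *\<^sub>R (1::complex)" "s' *\<^sub>R \<i>"] that by simp
      then show "dist (z + s *\<^sub>R 1 + s' *\<^sub>R \<i>) z \<le> s + s'"
        by (simp add: dist_norm add.assoc)
      then show "z + s *\<^sub>R 1 + s' *\<^sub>R \<i> \<in> S"
        using r(2) t that by (intro subsetD[OF r(2)]) (simp add: dist_commute)
    qed
    have inS': "z + s' *\<^sub>R \<i> + s *\<^sub>R 1 \<in> S" if "0 \<le> s" "s \<le> t" "0 \<le> s'" "s' \<le> t" for s s'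
      using inS(1)[OF that] by (simp add: algebra_simps)
    define \<Delta> where "\<Delta> = a (z + t *\<^sub>R 1 + t *\<^sub>R \<i>) - a (z + t *\<^sub>R 1) - a (z + t *\<^sub>R \<i>) + a z"
    have "\<exists>x. dist x z < 2 * t \<and> \<Delta> = t * (t * p' x \<i>)"
    proof -
      have "((\<lambda>x. a (x + t *\<^sub>R \<i>) - a x) has_derivative
          (\<lambda>x h. p (x + t *\<^sub>R \<i>) * Re h + q (x + t *\<^sub>R \<i>) * Im h - (p x * Re h + q x * Im h)) (z + s *\<^sub>R 1))
          (at (z + s *\<^sub>R 1))"
        if "0 \<le> s" "s \<le> t" for s
      proof -
        have 1: "((\<lambda>x. x + t *\<^sub>R \<i>) has_derivative (\<lambda>h. h)) (at (z + s *\<^sub>R 1))"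
          by (auto intro!: derivative_eq_intros)
        show ?thesis
          using has_derivative_diff[OF has_derivative_compose[OF 1 a] a] inS(1)[of s t] inS(1)[of s 0] that t
          by simp
      qed
      from mvt_direction[OF \<open>0 < t\<close>, of "\<lambda>x. a (x + t *\<^sub>R \<i>) - a x", OF this]
      obtain s where s: "0 < s" "s < t"
        "\<Delta> = t * (p (z + s *\<^sub>R 1 + t *\<^sub>R \<i>) - p (z + s *\<^sub>R 1))"
        unfolding \<Delta>_def by (auto simp: algebra_simps)
      have "(p has_derivative p' (z + s *\<^sub>R 1 + s' *\<^sub>R \<i>)) (at (z + s *\<^sub>R 1 + s' *\<^sub>R \<i>))"
        if "0 \<le> s'" "s' \<le> t" for s'
        using p inS(1)[of s s'] that s by simp
      from mvt_direction[OF \<open>0 < t\<close>, of p p', OF this]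
      obtain s' where s': "0 < s'" "s' < t"
        "p (z + s *\<^sub>R 1 + t *\<^sub>R \<i>) - p (z + s *\<^sub>R 1) = t * p' (z + s *\<^sub>R 1 + s' *\<^sub>R \<i>) \<i>"
        by auto
      show ?thesis
        using s s' inS(2)[of s s'] by (intro exI[of _ "z + s *\<^sub>R 1 + s' *\<^sub>R \<i>"]) auto
    qed
    moreover have "\<exists>x. dist x z < 2 * t \<and> \<Delta> = t * (t * q' x 1)"
    proof -
      have "((\<lambda>x. a (x + t *\<^sub>R 1) - a x) has_derivative
          (\<lambda>x h. p (x + t *\<^sub>R 1) * Re h + q (x + t *\<^sub>R 1) * Im h - (p x * Re h + q x * Im h)) (z + s *\<^sub>R \<i>))
          (at (z + s *\<^sub>R \<i>))"
        if "0 \<le> s" "s \<le> t" for s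
      proof -
        have 1: "((\<lambda>x. x + t *\<^sub>R 1) has_derivative (\<lambda>h. h)) (at (z + s *\<^sub>R \<i>))"
          by (auto intro!: derivative_eq_intros)
        show ?thesis
          using has_derivative_diff[OF has_derivative_compose[OF 1 a] a] inS'[of t s] inS'[of 0 s] that t
          by simp
      qed
      from mvt_direction[OF \<open>0 < t\<close>, of "\<lambda>x. a (x + t *\<^sub>R 1) - a x", OF this]
      obtain s where s: "0 < s" "s < t"
        "\<Delta> = t * (q (z + s *\<^sub>R \<i> + t *\<^sub>R 1) - q (z + s *\<^sub>R \<i>))"
        unfolding \<Delta>_def by (auto simp: algebra_simps)
      have "(q has_derivative q' (z + s *\<^sub>R \<i> + s' *\<^sub>R 1)) (at (z + s *\<^sub>R \<i> + s' *\<^sub>R 1))"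
        if "0 \<le> s'" "s' \<le> t" for s'
        using q inS'[of s' s] that s by simp
      from mvt_direction[OF \<open>0 < t\<close>, of q q', OF this]
      obtain s' where s': "0 < s'" "s' < t"
        "q (z + s *\<^sub>R \<i> + t *\<^sub>R 1) - q (z + s *\<^sub>R \<i>) = t * q' (z + s *\<^sub>R \<i> + s' *\<^sub>R 1) 1"
        by auto
      show ?thesis
        using s s' inS(2)[of s' s]
        by (intro exI[of _ "z + s *\<^sub>R \<i> + s' *\<^sub>R 1"]) (auto simp: algebra_simps)
    qed
    ultimately obtain x y where "dist x z < 2 * t" "dist y z < 2 * t"
      "t * (t * p' x \<i>) = t * (t * q' y 1)" by metis
    then show ?thesis using t by (intro exI[of _ x] exI[of _ y]) simp
  qed
  have close: "\<bar>p' z \<i> - q' z 1\<bar> < 2 * e" if "e > 0" for e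
  proof -
    obtain d1 where d1: "d1 > 0" "\<And>x. x \<in> S \<Longrightarrow> dist x z < d1 \<Longrightarrow> dist (p' x \<i>) (p' z \<i>) < e"
      using cp S \<open>e > 0\<close> unfolding continuous_on_iff by blast
    obtain d2 where d2: "d2 > 0" "\<And>x. x \<in> S \<Longrightarrow> dist x z < d2 \<Longrightarrow> dist (q' x 1) (q' z 1) < e"
      using cq S \<open>e > 0\<close> unfolding continuous_on_iff by blast
    \<comment> \<open>One third leaves \<open>2 * t\<close> strictly below all three radii.\<close>
    define t where "t = min r (min d1 d2) / 3"
    have t: "0 < t" "2 * t < r" "2 * t < d1" "2 * t < d2"
      using r d1 d2 by (auto simp: t_def)
    obtain x y where xy: "dist x z < 2 * t" "dist y z < 2 * t" "p' x \<i> = q' y 1"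
      using mixed[OF t(1,2)] by blast
    have "x \<in> S" "y \<in> S" using xy t r(2) by (auto simp: subset_iff dist_commute)
    then have "dist (p' x \<i>) (p' z \<i>) < e" "dist (q' y 1) (q' z 1) < e"
      using d1(2)[of x] d2(2)[of y] xy t by auto
    then show ?thesis using xy(3) by (simp add: dist_real_def)
  qed
  show ?thesis
  proof (rule ccontr)
    assume "p' z \<i> \<noteq> q' z 1"
    then have "0 < \<bar>p' z \<i> - q' z 1\<bar> / 2" by simp
    from close[OF this] show False by simp
  qed
qed

text \<open>Local, because on the exterior of a disk a function such as ln |x| has no global
  harmonic conjugate. Real-valued, because |exp f| = exp (Re f) turns the maximum modulus principle
  into a maximum principle for g.\<close>

definition locally_Re_holomorphic :: "complex set \<Rightarrow> (complex \<Rightarrow> real) \<Rightarrow> bool" where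
  "locally_Re_holomorphic S g \<longleftrightarrow>
     (\<forall>x\<in>S. \<exists>T f. open T \<and> x \<in> T \<and> T \<subseteq> S \<and> f holomorphic_on T \<and> (\<forall>y\<in>T. g y = Re (f y)))"

text \<open>The function a_x - i a_y satisfies the Cauchy-Riemann equations, so it has a primitive
  on a disk, and the real part of this primitive has the same gradient as \<open>a\<close>.\<close>

lemma locally_Re_holomorphic_partials:
  fixes a p q :: "complex \<Rightarrow> real"
  assumes S: "open S"
    and a: "\<And>x. x \<in> S \<Longrightarrow> (a has_derivative (\<lambda>h. p x * Re h + q x * Im h)) (at x)"
    and p: "\<And>x. x \<in> S \<Longrightarrow> (p has_derivative p' x) (at x)"
    and q: "\<And>x. x \<in> S \<Longrightarrow> (q has_derivative q' x) (at x)"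
    and cp: "continuous_on S (\<lambda>x. p' x \<i>)" and cq: "continuous_on S (\<lambda>x. q' x 1)"
    and lap: "\<And>x. x \<in> S \<Longrightarrow> p' x 1 + q' x \<i> = 0"
  shows "locally_Re_holomorphic S a"
  unfolding locally_Re_holomorphic_def
proof
  fix z assume "z \<in> S"
  then obtain r where r: "r > 0" "ball z r \<subseteq> S" using S openE by blast
  define \<phi> where "\<phi> x = complex_of_real (p x) - \<i> * complex_of_real (q x)" for x
  have "\<phi> field_differentiable at x" if "x \<in> S" for x
  proof -
    have d: "(\<phi> has_derivative (\<lambda>h. complex_of_real (p' x h) - \<i> * complex_of_real (q' x h))) (at x)"
      unfolding \<phi>_def by (intro derivative_intros p q that)
    have mix: "p' x \<i> = q' x 1"
      by (rule mixed_partials_eq[OF S that a p q cp cq])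
    have lin: "f h = Re h * f 1 + Im h * f \<i>" if "bounded_linear f" for f :: "complex \<Rightarrow> real" and h
    proof -
      interpret bounded_linear f by fact
      have "f h = f (Re h *\<^sub>R 1 + Im h *\<^sub>R \<i>)"
        by (rule arg_cong[of _ _ f]) (simp add: complex_eq_iff)
      then show ?thesis by (simp add: add scaleR)
    qed
    \<comment> \<open>The real part rests on the equality of the mixed derivatives, the imaginary
      part on the Laplace equation.\<close>
    have "complex_of_real (p' x h) - \<i> * complex_of_real (q' x h)
        = (complex_of_real (p' x 1) - \<i> * complex_of_real (q' x 1)) * h" for h
    proof (intro complex_eqI)
      have 1: "p' x h = Re h * p' x 1 + Im h * p' x \<i>" "q' x h = Re h * q' x 1 + Im h * q' x \<i>"
        by (intro lin has_derivative_bounded_linear[OF p[OF that]] has_derivative_bounded_linear[OF q[OF that]])+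
      have 2: "q' x \<i> = - p' x 1" using lap[OF that] by simp
      show "Re (complex_of_real (p' x h) - \<i> * complex_of_real (q' x h))
          = Re ((complex_of_real (p' x 1) - \<i> * complex_of_real (q' x 1)) * h)"
        by (simp add: 1 mix)
      show "Im (complex_of_real (p' x h) - \<i> * complex_of_real (q' x h))
          = Im ((complex_of_real (p' x 1) - \<i> * complex_of_real (q' x 1)) * h)"
        by (simp add: 1 2)
    qed
    then have "(\<lambda>h. complex_of_real (p' x h) - \<i> * complex_of_real (q' x h))
        = (*) (complex_of_real (p' x 1) - \<i> * complex_of_real (q' x 1))" by (rule ext)
    from d[unfolded this] have "(\<phi> has_field_derivative (complex_of_real (p' x 1) - \<i> * complex_of_real (q' x 1))) (at x)"
      unfolding has_field_derivative_def .
    then show ?thesis by (auto simp: field_differentiable_def)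
  qed
  then have "\<phi> holomorphic_on ball z r"
    using r(2) by (auto simp: holomorphic_on_def intro: field_differentiable_at_within)
  then obtain f where f: "\<And>x. x \<in> ball z r \<Longrightarrow> (f has_field_derivative \<phi> x) (at x)"
    using holomorphic_convex_primitive'[of "ball z r" \<phi>] by (auto simp: at_within_open[of _ "ball z r"])
  have "\<exists>c. \<forall>x\<in>ball z r. a x - Re (f x) = c"
  proof (rule has_derivative_zero_constant)
    fix x assume x: "x \<in> ball z r"
    have "(f has_derivative (\<lambda>h. \<phi> x * h)) (at x)"
      using f[OF x] by (simp add: has_field_derivative_def)
    then have "((\<lambda>x. a x - Re (f x)) has_derivative
        (\<lambda>h. (p x * Re h + q x * Im h) - Re (\<phi> x * h))) (at x)"
      using a x r(2) by (intro derivative_intros) auto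
    then show "((\<lambda>x. a x - Re (f x)) has_derivative (\<lambda>h. 0)) (at x within ball z r)"
      by (auto simp: \<phi>_def intro: has_derivative_at_withinI)
  qed auto
  then obtain c where c: "\<And>x. x \<in> ball z r \<Longrightarrow> a x = Re (f x) + c"
    by (metis diff_add_cancel add.commute)
  show "\<exists>T f. open T \<and> z \<in> T \<and> T \<subseteq> S \<and> f holomorphic_on T \<and> (\<forall>y\<in>T. a y = Re (f y))"
  proof (intro exI conjI ballI)
    have "f holomorphic_on ball z r"
      using f unfolding holomorphic_on_def field_differentiable_def by (metis has_field_derivative_at_within)
    then show "(\<lambda>x. f x + complex_of_real c) holomorphic_on ball z r"
      by (intro holomorphic_intros)
  qed (use r c in auto)
qed

section \<open>Closure properties of local real parts, and the logarithm of the norm\<close>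

lemma locally_Re_holomorphic_Re:
  assumes "open S" "f holomorphic_on S"
  shows "locally_Re_holomorphic S (\<lambda>x. Re (f x))"
  using assms unfolding locally_Re_holomorphic_def by (intro ballI exI[of _ S] exI[of _ f]) simp

lemma locally_Re_holomorphic_add:
  assumes "locally_Re_holomorphic S g" "locally_Re_holomorphic S h"
  shows "locally_Re_holomorphic S (\<lambda>x. g x + h x)"
  unfolding locally_Re_holomorphic_def
proof
  fix x assume "x \<in> S"
  then obtain T f T' f' where "open T" "x \<in> T" "T \<subseteq> S" "f holomorphic_on T" "\<forall>y\<in>T. g y = Re (f y)"
    "open T'" "x \<in> T'" "f' holomorphic_on T'" "\<forall>y\<in>T'. h y = Re (f' y)"
    using assms unfolding locally_Re_holomorphic_def by metis
  then show "\<exists>T f. open T \<and> x \<in> T \<and> T \<subseteq> S \<and> f holomorphic_on T \<and> (\<forall>y\<in>T. g y + h y = Re (f y))"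
    by (intro exI[of _ "T \<inter> T'"] exI[of _ "\<lambda>y. f y + f' y"])
       (auto intro!: holomorphic_intros intro: holomorphic_on_subset)
qed

lemma locally_Re_holomorphic_cmult:
  fixes c :: real
  assumes "locally_Re_holomorphic S g"
  shows "locally_Re_holomorphic S (\<lambda>x. c * g x)"
  unfolding locally_Re_holomorphic_def
proof
  fix x assume "x \<in> S"
  then obtain T f where "open T" "x \<in> T" "T \<subseteq> S" "f holomorphic_on T" "\<forall>y\<in>T. g y = Re (f y)"
    using assms unfolding locally_Re_holomorphic_def by metis
  then show "\<exists>T f. open T \<and> x \<in> T \<and> T \<subseteq> S \<and> f holomorphic_on T \<and> (\<forall>y\<in>T. c * g y = Re (f y))"
    by (intro exI[of _ T] exI[of _ "\<lambda>y. of_real c * f y"]) (auto intro!: holomorphic_intros)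
qed

lemma locally_Re_holomorphic_diff:
  assumes "locally_Re_holomorphic S g" "locally_Re_holomorphic S h"
  shows "locally_Re_holomorphic S (\<lambda>x. g x - h x)"
  using locally_Re_holomorphic_add[OF assms(1) locally_Re_holomorphic_cmult[OF assms(2), of "-1"]] by simp

lemma locally_Re_holomorphic_sum:
  assumes "open S" "\<And>i. i \<in> K \<Longrightarrow> locally_Re_holomorphic S (g i)"
  shows "locally_Re_holomorphic S (\<lambda>x. \<Sum>i\<in>K. g i x)"
  using assms(2)
proof (induction K rule: infinite_finite_induct)
  case (insert i K)
  then show ?case by (auto intro: locally_Re_holomorphic_add)
qed (use locally_Re_holomorphic_Re[OF assms(1), of "\<lambda>_. 0"] in auto)

text \<open>The branch is adapted to the point x: \<open>ln (y / x)\<close> is holomorphic off the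
  ray opposite to x, and x / x = 1 is away from the cut.\<close>

lemma locally_Re_holomorphic_ln_norm:
  assumes "open S" "0 \<notin> S"
  shows "locally_Re_holomorphic S (\<lambda>x. ln (norm x))"
  unfolding locally_Re_holomorphic_def
proof
  fix x assume x: "x \<in> S"
  then have "x \<noteq> 0" using assms by auto
  define T where "T = {y. y / x \<notin> \<real>\<^sub>\<le>\<^sub>0} \<inter> S"
  have "open ((\<lambda>y. y / x) -` (- \<real>\<^sub>\<le>\<^sub>0))"
    using \<open>x \<noteq> 0\<close> by (intro open_vimage continuous_intros) (auto simp: open_Compl)
  then have "open T"
    unfolding T_def using assms by (intro open_Int) (auto simp: vimage_def)
  have "x \<in> T" "T \<subseteq> S" using x \<open>x \<noteq> 0\<close> by (auto simp: T_def)
  have "ln (norm y) = Re (ln (y / x) + of_real (ln (norm x)))" if "y \<in> T" for y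
  proof -
    have "y \<noteq> 0" using that assms by (auto simp: T_def)
    then have "y / x \<noteq> 0" using \<open>x \<noteq> 0\<close> by simp
    then have "Re (ln (y / x)) = ln (norm (y / x))" by (rule Re_Ln)
    then show ?thesis using \<open>x \<noteq> 0\<close> \<open>y \<noteq> 0\<close> by (simp add: norm_divide ln_div)
  qed
  moreover have "(\<lambda>y. ln (y / x) + of_real (ln (norm x))) holomorphic_on T"
    using \<open>x \<noteq> 0\<close> by (intro holomorphic_intros) (auto simp: T_def)
  ultimately show "\<exists>T f. open T \<and> x \<in> T \<and> T \<subseteq> S \<and> f holomorphic_on T \<and> (\<forall>y\<in>T. ln (norm y) = Re (f y))"
    using \<open>open T\<close> \<open>x \<in> T\<close> \<open>T \<subseteq> S\<close> by blast
qed

section \<open>Continuity, the maximum principle and radial derivatives\<close>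

lemma locally_Re_holomorphic_continuous:
  assumes "locally_Re_holomorphic S g"
  shows "continuous_on S g"
proof -
  have "isCont g x" if x: "x \<in> S" for x
  proof -
    obtain T f where T: "open T" "x \<in> T" "f holomorphic_on T" "\<forall>y\<in>T. g y = Re (f y)"
      using assms x unfolding locally_Re_holomorphic_def by metis
    have "continuous_on T (\<lambda>x. Re (f x))"
      by (intro continuous_intros holomorphic_on_imp_continuous_on T)
    then have "continuous_on T g" by (rule continuous_on_eq) (use T in simp)
    then show ?thesis using T by (metis continuous_on_eq_continuous_at)
  qed
  then show ?thesis by (simp add: continuous_at_imp_continuous_on)
qed

text \<open>Compactness of the superlevel sets encodes that g is asymptotically nonpositive at the
  boundary of U and, for unbounded U, at infinity.\<close>

lemma locally_Re_holomorphic_max_principle: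
  assumes g: "locally_Re_holomorphic U g"
    and comp: "\<And>e. e > 0 \<Longrightarrow> compact {x \<in> U. e \<le> g x}" and "x \<in> U"
  shows "g x \<le> 0"
proof (rule ccontr)
  assume "\<not> g x \<le> 0"
  then have "g x > 0" by simp
  define K where "K = {y \<in> U. g x \<le> g y}"
  have K: "compact K" "x \<in> K" using comp[OF \<open>g x > 0\<close>] \<open>x \<in> U\<close> by (auto simp: K_def)
  have "continuous_on K g"
    using locally_Re_holomorphic_continuous[OF g] by (rule continuous_on_subset) (auto simp: K_def)
  then obtain x0 where x0: "x0 \<in> K" "\<And>y. y \<in> K \<Longrightarrow> g y \<le> g x0"
    using continuous_attains_sup[of K g] K by blast
  have max: "g y \<le> g x0" if "y \<in> U" for y
    using that x0 K by (cases "g x \<le> g y") (force simp: K_def)+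
  have "g x0 > 0" using x0 \<open>g x > 0\<close> K by force
  \<comment> \<open>The set of maximum points is compact as a superlevel set and open by the maximum
    modulus principle; no nonempty subset of the plane is both.\<close>
  define A where "A = {y \<in> U. g x0 \<le> g y}"
  have "compact A" unfolding A_def by (rule comp) fact
  moreover have "open A"
  proof (rule openI)
    fix y assume y: "y \<in> A"
    then have "y \<in> U" "g y = g x0" using max[of y] by (auto simp: A_def)
    then obtain T f where T: "open T" "y \<in> T" "T \<subseteq> U" "f holomorphic_on T" "\<forall>y\<in>T. g y = Re (f y)"
      using g unfolding locally_Re_holomorphic_def by metis
    obtain r where r: "r > 0" "ball y r \<subseteq> T" using T openE by blast
    have "(\<lambda>w. exp (f w)) constant_on ball y r"
    proof (rule maximum_modulus_principle[of _ _ "ball y r" y])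
      show "(\<lambda>w. exp (f w)) holomorphic_on ball y r"
        using T r by (intro holomorphic_intros) (auto intro: holomorphic_on_subset)
      fix w assume "w \<in> ball y r"
      then have "w \<in> T" using r by auto
      then have "g w = Re (f w)" "g y = Re (f y)" "g w \<le> g x0" using T(2,3,5) max[of w] by auto
      then show "norm (exp (f w)) \<le> norm (exp (f y))" using \<open>g y = g x0\<close> by simp
    qed (use r in auto)
    then obtain c where c: "\<And>w. w \<in> ball y r \<Longrightarrow> exp (f w) = c"
      by (auto simp: constant_on_def)
    have "g w = g y" if "w \<in> ball y r" for w
    proof -
      have "norm (exp (f w)) = norm (exp (f y))" using c[OF that] c[of y] r by simp
      then show ?thesis using T r that by auto
    qed
    then show "\<exists>e>0. ball y e \<subseteq> A"
      using r T \<open>g y = g x0\<close> by (intro exI[of _ r]) (auto simp: A_def)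
  qed
  moreover have "A \<noteq> {}" using x0 by (auto simp: A_def K_def)
  ultimately show False
    using clopen[of A] compact_imp_closed compact_imp_bounded not_bounded_UNIV by blast
qed

text \<open>Extended by 0, \<open>g\<close> is continuous on the closure of U, so its superlevel set
  there is closed; as e > 0, the added zeros do not belong to it.\<close>

lemma compact_superlevel_set:
  fixes g :: "complex \<Rightarrow> real"
  assumes "open U" and g: "continuous_on U g"
    and lim: "\<And>x. x \<in> frontier U \<Longrightarrow> (g \<longlongrightarrow> 0) (at x within U)"
    and bdd: "bounded {x \<in> U. e \<le> g x}" and "e > 0"
  shows "compact {x \<in> U. e \<le> g x}"
proof -
  define G where "G x = (if x \<in> U then g x else 0)" for x
  have "continuous_on (closure U) G"
    unfolding continuous_on_def
  proof
    fix x assume x: "x \<in> closure U"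
    show "(G \<longlongrightarrow> G x) (at x within closure U)"
    proof (cases "x \<in> U")
      case True
      then have "(g \<longlongrightarrow> g x) (at x)"
        using g \<open>open U\<close> by (simp add: continuous_on_eq_continuous_at isCont_def)
      moreover have "eventually (\<lambda>y. y \<in> U) (at x)"
        using \<open>open U\<close> True by (rule eventually_at_in_open')
      then have "eventually (\<lambda>y. g y = G y) (at x)"
        by (rule eventually_mono) (simp add: G_def)
      ultimately have "(G \<longlongrightarrow> g x) (at x)"
        by (rule Lim_transform_eventually)
      then have "(G \<longlongrightarrow> G x) (at x)"
        using True by (simp add: G_def)
      then show ?thesis by (rule tendsto_within_subset) simp
    next
      case False
      then have "x \<in> frontier U" using x \<open>open U\<close> by (simp add: frontier_def interior_open)
      from lim[OF this] have L: "(g \<longlongrightarrow> 0) (at x within U)" .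
      show ?thesis
        using L False unfolding tendsto_iff eventually_at_filter
        by (auto simp: G_def elim!: eventually_mono)
    qed
  qed
  then have "closed {x \<in> closure U. e \<le> G x}"
    using continuous_closed_preimage[of "closure U" G "{e..}"] by (simp add: vimage_def Int_def)
  moreover have "{x \<in> closure U. e \<le> G x} = {x \<in> U. e \<le> g x}"
    using \<open>e > 0\<close> closure_subset[of U] by (auto simp: G_def split: if_splits)
  ultimately show ?thesis using bdd by (simp add: compact_eq_bounded_closed)
qed

lemma locally_Re_holomorphic_local:
  assumes "locally_Re_holomorphic S g" "x \<in> S"
  obtains T f where "open T" "x \<in> T" "T \<subseteq> S" "f holomorphic_on T" "\<And>y. y \<in> T \<Longrightarrow> g y = Re (f y)"
    "\<And>y. y \<in> T \<Longrightarrow> (g has_derivative (\<lambda>h. Re (deriv f y * h))) (at y)"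
proof -
  obtain T f where T: "open T" "x \<in> T" "T \<subseteq> S" "f holomorphic_on T" "\<And>y. y \<in> T \<Longrightarrow> g y = Re (f y)"
    using assms unfolding locally_Re_holomorphic_def by metis
  have "(g has_derivative (\<lambda>h. Re (deriv f y * h))) (at y)" if y: "y \<in> T" for y
  proof -
    have "(f has_derivative (\<lambda>h. deriv f y * h)) (at y)"
      using holomorphic_derivI[OF T(4,1) y] by (simp add: has_field_derivative_def)
    then have "((\<lambda>y. Re (f y)) has_derivative (\<lambda>h. Re (deriv f y * h))) (at y)"
      by (rule has_derivative_Re)
    then show ?thesis
      by (rule has_derivative_transform_within_open[OF _ T(1) y]) (use T(5) in simp)
  qed
  then show ?thesis using T that by blast
qed

lemma locally_Re_holomorphic_differentiable:
  assumes "locally_Re_holomorphic S g" "x \<in> S"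
  shows "(g has_derivative frechet_derivative g (at x)) (at x)"
proof -
  obtain T f where "x \<in> T" "\<And>y. y \<in> T \<Longrightarrow> (g has_derivative (\<lambda>h. Re (deriv f y * h))) (at y)"
    using locally_Re_holomorphic_local[OF assms] by metis
  then have "g differentiable at x" by (auto simp: differentiable_def)
  then show ?thesis by (simp add: frechet_derivative_works)
qed

text \<open>With g = Re f the radial derivative is Re (z f'(z)).\<close>

lemma locally_Re_holomorphic_radial:
  assumes "locally_Re_holomorphic S g"
  shows "locally_Re_holomorphic S (\<lambda>x. frechet_derivative g (at x) x)"
  unfolding locally_Re_holomorphic_def
proof
  fix x assume x: "x \<in> S"
  obtain T f where T: "open T" "x \<in> T" "T \<subseteq> S" "f holomorphic_on T"
    "\<And>y. y \<in> T \<Longrightarrow> (g has_derivative (\<lambda>h. Re (deriv f y * h))) (at y)"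
    using locally_Re_holomorphic_local[OF assms x] by metis
  have "frechet_derivative g (at y) y = Re (deriv f y * y)" if "y \<in> T" for y
    using frechet_derivative_at[OF T(5)[OF that]] by (metis (no_types, lifting))
  moreover have "(\<lambda>y. deriv f y * y) holomorphic_on T"
    using T by (intro holomorphic_intros)
  ultimately show "\<exists>T f. open T \<and> x \<in> T \<and> T \<subseteq> S \<and> f holomorphic_on T \<and>
      (\<forall>y\<in>T. frechet_derivative g (at y) y = Re (f y))"
    using T by blast
qed

section \<open>Uniqueness on the disk and on its exterior\<close>

lemma ball_vanishing_boundary_values:
  assumes "locally_Re_holomorphic (ball 0 r) g"
    and "\<And>x. norm x = r \<Longrightarrow> (g \<longlongrightarrow> 0) (at x within ball 0 r)" and "x \<in> ball 0 r"
  shows "g x = 0"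
proof -
  have r: "r > 0" using assms(3) by (simp add: order_le_less_trans[OF norm_ge_zero])
  have "h x \<le> 0" if h: "locally_Re_holomorphic (ball 0 r) h"
    "\<And>x. norm x = r \<Longrightarrow> (h \<longlongrightarrow> 0) (at x within ball 0 r)" for h
  proof (rule locally_Re_holomorphic_max_principle[OF h(1) _ assms(3)])
    fix e :: real assume "e > 0"
    show "compact {x \<in> ball 0 r. e \<le> h x}"
    proof (rule compact_superlevel_set)
      show "continuous_on (ball 0 r) h" by (rule locally_Re_holomorphic_continuous[OF h(1)])
      show "(h \<longlongrightarrow> 0) (at x within ball 0 r)" if "x \<in> frontier (ball 0 r)" for x
        using h(2)[of x] that r by simp
      show "bounded {x \<in> ball 0 r. e \<le> h x}"
        by (rule bounded_subset[of "ball 0 r"]) auto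
    qed (use \<open>e > 0\<close> in auto)
  qed
  from this[OF assms(1,2)] this[OF locally_Re_holomorphic_cmult[OF assms(1), of "-1"]]
  show ?thesis using tendsto_minus[OF assms(2)] by fastforce
qed

text \<open>The radial derivative is harmonic with zero boundary values, hence zero inside, so
  \<open>g\<close> is constant on every segment from the centre. The direction at y is y itself
  rather than a unit vector, which keeps the derivative harmonic and defined at 0.\<close>

lemma ball_vanishing_radial_derivative:
  assumes g: "locally_Re_holomorphic (ball 0 r) g"
    and lim: "\<And>x. norm x = r \<Longrightarrow> ((\<lambda>y. frechet_derivative g (at y) y) \<longlongrightarrow> 0) (at x within ball 0 r)"
    and x: "x \<in> ball 0 r"
  shows "g x = g 0"
proof -
  have q: "frechet_derivative g (at y) y = 0" if "y \<in> ball 0 r" for y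
    using ball_vanishing_boundary_values[OF locally_Re_holomorphic_radial[OF g] lim that] .
  have inb: "t *\<^sub>R x \<in> ball 0 r" if "0 \<le> t" "t \<le> 1" for t
    using x that mult_left_le_one_le[of "norm x" t] by (simp add: order_le_less_trans)
  have "g (1 *\<^sub>R x) = g (0 *\<^sub>R x)"
  proof (rule DERIV_isconst2[of 0 1])
    have "continuous_on ((\<lambda>t. t *\<^sub>R x) ` {0..1}) g"
      by (rule continuous_on_subset[OF locally_Re_holomorphic_continuous[OF g]]) (use inb in auto)
    then show "continuous_on {0..1} (\<lambda>t. g (t *\<^sub>R x))"
      by (intro continuous_on_compose2[of _ g _ "\<lambda>t. t *\<^sub>R x"] continuous_intros) auto
    fix t :: real assume t: "0 < t" "t < 1"
    let ?G = "frechet_derivative g (at (t *\<^sub>R x))"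
    have G: "(g has_derivative ?G) (at (t *\<^sub>R x))"
      using inb t by (intro locally_Re_holomorphic_differentiable[OF g]) auto
    have lin: "?G (c *\<^sub>R x) = c * ?G x" for c
      using has_derivative_bounded_linear[OF G] by (simp add: linear_simps)
    \<comment> \<open>The derivative known to vanish at t x is the one in direction t x; linearity
      and t > 0 turn it into direction x, along which the segment runs.\<close>
    have "?G x = 0" using q[OF inb[of t]] lin[of t] t by simp
    moreover have "((\<lambda>t. t *\<^sub>R x) has_derivative (\<lambda>h. h *\<^sub>R x)) (at t)"
      by (auto intro!: derivative_eq_intros)
    from has_derivative_compose[OF this G]
    have "((\<lambda>t. g (t *\<^sub>R x)) has_derivative (\<lambda>h. ?G (h *\<^sub>R x))) (at t)" .
    ultimately show "((\<lambda>t. g (t *\<^sub>R x)) has_real_derivative 0) (at t)"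
      by (simp add: lin has_field_derivative_def mult_zero_left[abs_def])
  qed auto
  then show ?thesis by simp
qed

text \<open>Adding a small multiple of ln (norm x) turns boundedness at infinity into decay to minus
  infinity, so that the maximum principle applies on the unbounded exterior domain.\<close>

lemma exterior_vanishing_boundary_values:
  assumes r: "r > 0" and h: "locally_Re_holomorphic {x. r < norm x} h"
    and lim: "\<And>x. norm x = r \<Longrightarrow> (h \<longlongrightarrow> 0) (at x within {x. r < norm x})"
    and bdd: "eventually (\<lambda>x. \<bar>h x\<bar> \<le> M) at_infinity" and x: "r < norm x"
  shows "h x = 0"
proof -
  have op: "open {x::complex. r < norm x}"
    by (intro open_Collect_less continuous_intros)
  have le: "k x \<le> \<delta> * (ln (norm x) - ln r)"
    if k: "locally_Re_holomorphic {x. r < norm x} k"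
      "\<And>x. norm x = r \<Longrightarrow> (k \<longlongrightarrow> 0) (at x within {x. r < norm x})"
      "eventually (\<lambda>x. \<bar>k x\<bar> \<le> M) at_infinity" and "\<delta> > 0" for k \<delta>
  proof -
    define g where "g x = k x - \<delta> * (ln (norm x) - ln r)" for x
    have g: "locally_Re_holomorphic {x. r < norm x} g"
      unfolding g_def using r
      by (intro locally_Re_holomorphic_diff k locally_Re_holomorphic_cmult locally_Re_holomorphic_ln_norm op
          locally_Re_holomorphic_Re[OF op, of "\<lambda>_. of_real (ln r)", simplified]) auto
    obtain R where R: "\<And>x. R \<le> norm x \<Longrightarrow> \<bar>k x\<bar> \<le> M"
      using k(3) unfolding eventually_at_infinity by blast
    have "g x \<le> 0"
    proof (rule locally_Re_holomorphic_max_principle[OF g])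
      fix e :: real assume e: "e > 0"
      show "compact {x \<in> {x. r < norm x}. e \<le> g x}"
      proof (rule compact_superlevel_set[OF op])
        show "continuous_on {x. r < norm x} g" by (rule locally_Re_holomorphic_continuous[OF g])
        fix y :: complex assume "y \<in> frontier {x. r < norm x}"
        moreover have "{x::complex. r < norm x} = - cball 0 r" by auto
        ultimately have "norm y = r" using r by (simp add: frontier_complement)
        then have "(g \<longlongrightarrow> 0 - \<delta> * (ln (norm y) - ln r)) (at y within {x. r < norm x})"
          unfolding g_def using r by (intro tendsto_intros k(2)) auto
        then show "(g \<longlongrightarrow> 0) (at y within {x. r < norm x})" using \<open>norm y = r\<close> by simp
      next
        \<comment> \<open>Beyond both radii \<open>k\<close> is at most M while the logarithmic term
          exceeds M, so \<open>g\<close> is negative.\<close>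
        have "norm y \<le> max R (r * exp (M / \<delta>))" if "r < norm y" "e \<le> g y" for y
        proof (rule ccontr)
          assume *: "\<not> norm y \<le> max R (r * exp (M / \<delta>))"
          then have "ln (r * exp (M / \<delta>)) < ln (norm y)" using r that by (subst ln_less_cancel_iff) auto
          then have "M / \<delta> < ln (norm y) - ln r" using r by (simp add: ln_mult)
          then have "M < \<delta> * (ln (norm y) - ln r)" using \<open>\<delta> > 0\<close> by (simp add: field_simps)
          moreover have "R \<le> norm y" using * by simp
          then have "k y \<le> M" using R[of y] by linarith
          ultimately show False using that e by (simp add: g_def)
        qed
        then show "bounded {x \<in> {x. r < norm x}. e \<le> g x}" by (auto simp: bounded_iff)
      qed fact
    qed (use x in simp)
    then show ?thesis by (simp add: g_def)
  qed
  have le0: "k x \<le> 0"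
    if k: "locally_Re_holomorphic {x. r < norm x} k"
      "\<And>x. norm x = r \<Longrightarrow> (k \<longlongrightarrow> 0) (at x within {x. r < norm x})"
      "eventually (\<lambda>x. \<bar>k x\<bar> \<le> M) at_infinity" for k
  proof (rule ccontr)
    assume "\<not> k x \<le> 0"
    define L where "L = ln (norm x) - ln r"
    have "0 < norm x" using x r by linarith
    then have "L > 0" using x r by (simp add: L_def)
    \<comment> \<open>With this coefficient the inequality says k x <= k x / 2, impossible for
      positive k x.\<close>
    have "k x \<le> (k x / (2 * L)) * L"
      unfolding L_def using \<open>\<not> k x \<le> 0\<close> \<open>L > 0\<close> by (intro le[OF k]) (auto simp: L_def)
    then show False using \<open>L > 0\<close> \<open>\<not> k x \<le> 0\<close> by simp
  qed
  have "h x \<le> 0" by (rule le0[OF h lim bdd])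
  moreover have "- h x \<le> 0"
    using locally_Re_holomorphic_cmult[OF h, of "-1"] tendsto_minus[OF lim] bdd
    by (intro le0) auto
  ultimately show ?thesis by simp
qed

section \<open>Reflection in the circle\<close>

definition circle_reflection :: "real \<Rightarrow> complex \<Rightarrow> complex" where
  "circle_reflection r x = of_real (r\<^sup>2) / cnj x"

lemma circle_reflection_has_derivative:
  assumes "x \<noteq> 0"
  shows "(circle_reflection r has_derivative (\<lambda>h. - of_real (r\<^sup>2) * cnj h / (cnj x)\<^sup>2)) (at x)"
proof -
  have "((\<lambda>y. of_real (r\<^sup>2) / y) has_derivative (\<lambda>h. (- of_real (r\<^sup>2) / (cnj x)\<^sup>2) * h)) (at (cnj x))"
    using assms by (intro has_field_derivative_imp_has_derivative)
      (auto intro!: derivative_eq_intros simp: power2_eq_square)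
  from has_derivative_compose[OF has_derivative_cnj[OF has_derivative_ident] this]
  show ?thesis by (simp add: circle_reflection_def[abs_def])
qed

lemma norm_circle_reflection: "norm (circle_reflection r x) = r\<^sup>2 / norm x"
  by (simp add: circle_reflection_def norm_divide norm_power)

lemma norm_circle_reflection_less:
  fixes x :: complex
  assumes "r > 0" "r < norm x"
  shows "norm (circle_reflection r x) < r"
proof -
  have "0 < norm x" using assms by linarith
  moreover have "r * r < r * norm x" using assms by simp
  ultimately show ?thesis by (simp add: norm_circle_reflection power2_eq_square divide_less_eq)
qed

lemma circle_reflection_fixed:
  fixes x :: complex
  assumes "norm x = r" "r > 0"
  shows "circle_reflection r x = x"
proof -
  have "x \<noteq> 0" using assms by auto
  moreover have "x * cnj x = of_real (r\<^sup>2)" using assms(1) by (metis complex_norm_square)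
  ultimately show ?thesis by (simp add: circle_reflection_def field_simps)
qed

text \<open>The reflection is antiholomorphic, so \<open>f\<close> composed with it is not
  holomorphic. Its conjugate is: it is \<open>cnj \<circ> f \<circ> cnj\<close> composed with y ->
  r^2 / y, and it has the same real part.\<close>

lemma locally_Re_holomorphic_reflection:
  assumes r: "r > 0" and g: "locally_Re_holomorphic (ball 0 r) g"
  shows "locally_Re_holomorphic {x. r < norm x} (\<lambda>x. g (circle_reflection r x))"
  unfolding locally_Re_holomorphic_def
proof
  fix x :: complex assume x: "x \<in> {x. r < norm x}"
  have op: "open {x::complex. r < norm x}"
    by (intro open_Collect_less continuous_intros)
  have "circle_reflection r x \<in> ball 0 r" using norm_circle_reflection_less[OF r] x by simp
  then obtain T f where T: "open T" "circle_reflection r x \<in> T" "f holomorphic_on T"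
    "\<And>y. y \<in> T \<Longrightarrow> g y = Re (f y)"
    using locally_Re_holomorphic_local[OF g] by metis
  define T' where "T' = {x. r < norm x} \<inter> circle_reflection r -` T"
  have nz: "y \<noteq> 0" if "r < norm y" for y :: complex using that r by auto
  have "continuous_on {x. r < norm x} (circle_reflection r)"
    by (intro continuous_at_imp_continuous_on ballI has_derivative_continuous[OF circle_reflection_has_derivative])
       (use nz in auto)
  then have "open T'" unfolding T'_def by (rule continuous_open_preimage[OF _ op T(1)])
  have "open (cnj ` T)"
    unfolding image_cnj_conv_vimage_cnj using T(1) by (intro open_vimage) (auto intro!: continuous_intros)
  then have "cnj \<circ> f \<circ> cnj holomorphic_on cnj ` T"
    by (intro holomorphic_on_compose_cnj_cnj) (use T(3) in \<open>simp_all add: image_image\<close>)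
  moreover have "(\<lambda>y. of_real (r\<^sup>2) / y) holomorphic_on T'"
    using nz by (intro holomorphic_intros) (auto simp: T'_def)
  moreover have "(\<lambda>y. of_real (r\<^sup>2) / y) ` T' \<subseteq> cnj ` T"
  proof
    fix z assume "z \<in> (\<lambda>y. of_real (r\<^sup>2) / y) ` T'"
    then obtain y where y: "circle_reflection r y \<in> T" "z = of_real (r\<^sup>2) / y" by (auto simp: T'_def)
    then have "z = cnj (circle_reflection r y)" by (simp add: circle_reflection_def)
    then show "z \<in> cnj ` T" using y by blast
  qed
  ultimately have "(cnj \<circ> f \<circ> cnj) \<circ> (\<lambda>y. of_real (r\<^sup>2) / y) holomorphic_on T'"
    by (metis holomorphic_on_compose_gen)
  moreover have "\<forall>y\<in>T'. g (circle_reflection r y) = Re (((cnj \<circ> f \<circ> cnj) \<circ> (\<lambda>y. of_real (r\<^sup>2) / y)) y)"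
    using T(4) by (auto simp: T'_def circle_reflection_def)
  moreover have "x \<in> T'" using x T by (simp add: T'_def)
  moreover have "T' \<subseteq> {x. r < norm x}" by (auto simp: T'_def)
  ultimately show "\<exists>T f. open T \<and> x \<in> T \<and> T \<subseteq> {x. r < norm x} \<and> f holomorphic_on T \<and>
      (\<forall>y\<in>T. g (circle_reflection r y) = Re (f y))"
    using \<open>open T'\<close> by blast
qed

section \<open>One-sided derivatives at the circle\<close>

lemma ddir_has_derivative:
  assumes "u differentiable at x"
  shows "(u has_derivative (\<lambda>w. ddir w u x)) (at x)"
  using assms by (simp add: ddir_def[abs_def] frechet_derivative_works)

lemma ddir_eq:
  assumes "(u has_derivative u') (at x)"
  shows "ddir w u x = u' w"
  using frechet_derivative_at[OF assms] by (simp add: ddir_def)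

lemma ddir_components:
  assumes "u differentiable at x"
  shows "ddir w u x = of_real (Re w) * ddir 1 u x + of_real (Im w) * ddir \<i> u x"
proof -
  have "bounded_linear (\<lambda>w. ddir w u x)"
    by (rule has_derivative_bounded_linear[OF ddir_has_derivative[OF assms]])
  then interpret bounded_linear "\<lambda>w. ddir w u x" .
  have "ddir w u x = ddir (Re w *\<^sub>R 1 + Im w *\<^sub>R \<i>) u x"
    by (rule arg_cong[of _ _ "\<lambda>w. ddir w u x"]) (simp add: complex_eq_iff)
  also have "\<dots> = Re w *\<^sub>R ddir 1 u x + Im w *\<^sub>R ddir \<i> u x"
    by (simp only: add scaleR)
  finally show ?thesis by (simp add: scaleR_conv_of_real)
qed

lemma harmonic_on_differentiable:
  assumes "harmonic_on S u" "x \<in> S"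
  shows "u differentiable at x"
  using assms unfolding harmonic_on_def differentiable_on_def by (metis at_within_open)

lemma harmonic_on_subset:
  assumes "harmonic_on S u" "open T" "T \<subseteq> S"
  shows "harmonic_on T u"
  using assms unfolding harmonic_on_def
  by (auto intro: differentiable_on_subset continuous_on_subset)

lemma ddir_cong_open:
  assumes "open S" "x \<in> S" "\<And>y. y \<in> S \<Longrightarrow> u y = v y" "u differentiable at x"
  shows "ddir w v x = ddir w u x" "v differentiable at x"
proof -
  have "(v has_derivative (\<lambda>w. ddir w u x)) (at x)"
    by (rule has_derivative_transform_within_open[OF ddir_has_derivative[OF assms(4)] assms(1,2,3)])
  then show "ddir w v x = ddir w u x" "v differentiable at x"
    by (auto simp: ddir_eq differentiable_def)
qed

lemma ddir_diff:
  assumes "u differentiable at x" "v differentiable at x"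
  shows "ddir w (\<lambda>y. u y - v y) x = ddir w u x - ddir w v x"
  by (rule ddir_eq[OF has_derivative_diff[OF assms[THEN ddir_has_derivative]]])

text \<open>\<open>ddir\<close> of the difference splits only at points of S, where both fields are
  differentiable; second derivatives are therefore compared through equality on the open set S. The
  lemma serves the field from which the single-mode fields are subtracted.\<close>

lemma harmonic_on_diff:
  assumes u: "harmonic_on S u" and v: "harmonic_on S v"
  shows "harmonic_on S (\<lambda>x. u x - v x)"
proof -
  have S: "open S" using u by (simp add: harmonic_on_def)
  have 1: "ddir w (\<lambda>y. u y - v y) x = ddir w u x - ddir w v x" if "x \<in> S" for x w
    using that u v by (intro ddir_diff harmonic_on_differentiable)
  have d: "ddir a f differentiable at x" if "harmonic_on S f" "a \<in> {1, \<i>}" "x \<in> S" for a f x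
    using that unfolding harmonic_on_def differentiable_on_def by (metis at_within_open)
  have 2: "ddir w (ddir a (\<lambda>y. u y - v y)) x = ddir w (ddir a u) x - ddir w (ddir a v) x"
    "ddir a (\<lambda>y. u y - v y) differentiable at x"
    if "x \<in> S" "a \<in> {1, \<i>}" for x w a
  proof -
    have "(\<lambda>x. ddir a u x - ddir a v x) differentiable at x"
      using d[OF u that(2,1)] d[OF v that(2,1)] by (rule differentiable_diff)
    from ddir_cong_open[OF S that(1) _ this, of "ddir a (\<lambda>y. u y - v y)"]
    show "ddir w (ddir a (\<lambda>y. u y - v y)) x = ddir w (ddir a u) x - ddir w (ddir a v) x"
      "ddir a (\<lambda>y. u y - v y) differentiable at x"
      using 1 ddir_diff[OF d[OF u that(2,1)] d[OF v that(2,1)]] by auto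
  qed
  show ?thesis
    unfolding harmonic_on_def
  proof (intro conjI ballI)
    show "(\<lambda>x. u x - v x) differentiable_on S"
      using u v by (simp add: harmonic_on_def differentiable_on_diff)
    fix a assume a: "a \<in> {1, \<i>}"
    show "ddir a (\<lambda>x. u x - v x) differentiable_on S"
      using 2(2)[OF _ a] by (simp add: differentiable_at_imp_differentiable_on)
    fix w assume w: "w \<in> {1, \<i>}"
    have "continuous_on S (\<lambda>x. ddir w (ddir a u) x - ddir w (ddir a v) x)"
      using u v a w unfolding harmonic_on_def by (intro continuous_on_diff) blast+
    then show "continuous_on S (ddir w (ddir a (\<lambda>x. u x - v x)))"
      by (rule continuous_on_eq) (use 2(1)[OF _ a] in simp)
  next
    fix x assume x: "x \<in> S"
    have "laplacian u x = 0" "laplacian v x = 0" using u v x by (auto simp: harmonic_on_def)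
    moreover have D: "ddir 1 (ddir 1 (\<lambda>x. u x - v x)) x = ddir 1 (ddir 1 u) x - ddir 1 (ddir 1 v) x"
      "ddir \<i> (ddir \<i> (\<lambda>x. u x - v x)) x = ddir \<i> (ddir \<i> u) x - ddir \<i> (ddir \<i> v) x"
      by (rule 2(1)[OF x]; simp)+
    have "laplacian (\<lambda>x. u x - v x) x = laplacian u x - laplacian v x"
      by (simp only: laplacian_def D) simp
    ultimately show "laplacian (\<lambda>x. u x - v x) x = 0" by simp
  qed (rule S)
qed

text \<open>The choices c = 1 and c = -i give the real and the imaginary part. Asking for every c
  makes multiplication by complex constants such as 1 + eps immediate.\<close>

definition loc_harmonic_on :: "complex set \<Rightarrow> (complex \<Rightarrow> complex) \<Rightarrow> bool" where
  "loc_harmonic_on S u \<longleftrightarrow> (\<forall>c. locally_Re_holomorphic S (\<lambda>x. Re (c * u x)))"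

lemma harmonic_on_imp_loc_harmonic_on:
  assumes u: "harmonic_on S u"
  shows "loc_harmonic_on S u"
  unfolding loc_harmonic_on_def
proof
  fix c
  have S: "open S" using u by (simp add: harmonic_on_def)
  have d: "ddir a u differentiable at x" if "a \<in> {1, \<i>}" "x \<in> S" for a x
    using u that unfolding harmonic_on_def differentiable_on_def by (metis at_within_open)
  show "locally_Re_holomorphic S (\<lambda>x. Re (c * u x))"
  proof (rule locally_Re_holomorphic_partials[OF S])
    fix x assume x: "x \<in> S"
    have "((\<lambda>x. Re (c * u x)) has_derivative (\<lambda>h. Re (c * ddir h u x))) (at x)"
      by (intro derivative_intros ddir_has_derivative harmonic_on_differentiable[OF u x])
    moreover have "(\<lambda>h. Re (c * ddir h u x)) = (\<lambda>h. Re (c * ddir 1 u x) * Re h + Re (c * ddir \<i> u x) * Im h)"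
      by (rule ext, subst ddir_components[OF harmonic_on_differentiable[OF u x]]) (simp add: algebra_simps)
    ultimately show "((\<lambda>x. Re (c * u x)) has_derivative
        (\<lambda>h. Re (c * ddir 1 u x) * Re h + Re (c * ddir \<i> u x) * Im h)) (at x)"
      by (rule back_subst[where P = "\<lambda>f. (_ has_derivative f) _"])
    show "((\<lambda>x. Re (c * ddir 1 u x)) has_derivative (\<lambda>h. Re (c * ddir h (ddir 1 u) x))) (at x)"
      by (intro derivative_intros ddir_has_derivative d x) simp
    show "((\<lambda>x. Re (c * ddir \<i> u x)) has_derivative (\<lambda>h. Re (c * ddir h (ddir \<i> u) x))) (at x)"
      by (intro derivative_intros ddir_has_derivative d x) simp
    have "Re (c * laplacian u x) = 0" using u x by (simp add: harmonic_on_def)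
    then show "Re (c * ddir 1 (ddir 1 u) x) + Re (c * ddir \<i> (ddir \<i> u) x) = 0"
      by (simp add: laplacian_def algebra_simps)
  next
    show "continuous_on S (\<lambda>x. Re (c * ddir \<i> (ddir 1 u) x))" "continuous_on S (\<lambda>x. Re (c * ddir 1 (ddir \<i> u) x))"
      using u unfolding harmonic_on_def by (intro continuous_intros; blast)+
  qed
qed

lemma loc_harmonic_on_diff:
  "loc_harmonic_on S u \<Longrightarrow> loc_harmonic_on S v \<Longrightarrow> loc_harmonic_on S (\<lambda>x. u x - v x)"
  unfolding loc_harmonic_on_def by (simp add: right_diff_distrib locally_Re_holomorphic_diff)

lemma loc_harmonic_on_cmult:
  "loc_harmonic_on S u \<Longrightarrow> loc_harmonic_on S (\<lambda>x. c * u x)"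
  unfolding loc_harmonic_on_def by (simp only: mult.assoc[symmetric]) blast

lemma loc_harmonic_on_sum:
  assumes "open S" "\<And>i. i \<in> K \<Longrightarrow> loc_harmonic_on S (u i)"
  shows "loc_harmonic_on S (\<lambda>x. \<Sum>i\<in>K. u i x)"
  using assms unfolding loc_harmonic_on_def
  by (simp add: sum_distrib_left Re_sum locally_Re_holomorphic_sum)

lemma loc_harmonic_on_of_real_Re:
  assumes "open S" "f holomorphic_on S"
  shows "loc_harmonic_on S (\<lambda>x. of_real (Re (f x)))"
  using locally_Re_holomorphic_cmult[OF locally_Re_holomorphic_Re[OF assms]]
  by (simp add: loc_harmonic_on_def)

lemma loc_harmonic_on_const:
  assumes "open S"
  shows "loc_harmonic_on S (\<lambda>x. c)"
  using loc_harmonic_on_cmult[OF loc_harmonic_on_of_real_Re[OF assms holomorphic_on_const[of 1]], of c]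
  by simp

lemma loc_harmonic_on_reflection:
  assumes "r > 0" "loc_harmonic_on (ball 0 r) u"
  shows "loc_harmonic_on {x. r < norm x} (\<lambda>x. u (circle_reflection r x))"
  using assms locally_Re_holomorphic_reflection unfolding loc_harmonic_on_def by blast

lemma open_exterior: "open {x::complex. r < norm x}"
  by (intro open_Collect_less continuous_intros)

lemma loc_harmonic_on_exterior_vanish:
  assumes r: "r > 0" and h: "loc_harmonic_on {x. r < norm x} h"
    and lim: "\<And>x. norm x = r \<Longrightarrow> (h \<longlongrightarrow> 0) (at x within {x. r < norm x})"
    and inf: "(h \<longlongrightarrow> l) at_infinity" and x: "r < norm x"
  shows "h x = 0"
proof -
  have "Re (c * h x) = 0" for c
  proof (rule exterior_vanishing_boundary_values[OF r _ _ _ x])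
    show "locally_Re_holomorphic {x. r < norm x} (\<lambda>x. Re (c * h x))"
      using h by (simp add: loc_harmonic_on_def)
    show "((\<lambda>x. Re (c * h x)) \<longlongrightarrow> 0) (at x within {x. r < norm x})" if "norm x = r" for x
      using tendsto_Re[OF tendsto_mult_left[OF lim[OF that], of c]] by simp
    have "((\<lambda>x. \<bar>Re (c * h x)\<bar>) \<longlongrightarrow> \<bar>Re (c * l)\<bar>) at_infinity"
      by (intro tendsto_intros inf)
    then have "eventually (\<lambda>x. \<bar>Re (c * h x)\<bar> < \<bar>Re (c * l)\<bar> + 1) at_infinity"
      by (rule order_tendstoD) simp
    then show "eventually (\<lambda>x. \<bar>Re (c * h x)\<bar> \<le> \<bar>Re (c * l)\<bar> + 1) at_infinity"
      by (rule eventually_mono) simp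
  qed
  from this[of 1] this[of "- \<i>"] show ?thesis by (simp add: complex_eq_iff)
qed

text \<open>\<open>bderiv\<close> is a \<open>Lim\<close>, which has a value even where no limit
  exists; this predicate carries the convergence, for all directions at once. Eventual
  differentiability is included so that linearity in the direction passes to the limit.\<close>

definition has_side_derivative ::
  "(complex \<Rightarrow> complex) \<Rightarrow> (complex \<Rightarrow> complex) \<Rightarrow> complex \<Rightarrow> complex set \<Rightarrow> bool" where
  "has_side_derivative u G x A \<longleftrightarrow> eventually (\<lambda>y. u differentiable at y) (at x within A) \<and>
     (\<forall>w. (ddir w u \<longlongrightarrow> G w) (at x within A))"

lemma has_side_derivative_C1:
  assumes "C1_up_to A B u" "x \<in> B" and d: "\<And>y. y \<in> A \<Longrightarrow> u differentiable at y"
    and nt: "at x within A \<noteq> bot"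
  shows "has_side_derivative u (\<lambda>w. bderiv A w u x) x A"
  unfolding has_side_derivative_def
proof (intro conjI allI)
  show ev: "eventually (\<lambda>y. u differentiable at y) (at x within A)"
    using d by (simp add: eventually_at_filter)
  fix w
  obtain L1 L2 where L: "(ddir 1 u \<longlongrightarrow> L1) (at x within A)" "(ddir \<i> u \<longlongrightarrow> L2) (at x within A)"
    using assms(1,2) by (auto simp: C1_up_to_def)
  have "((\<lambda>y. of_real (Re w) * ddir 1 u y + of_real (Im w) * ddir \<i> u y)
      \<longlongrightarrow> of_real (Re w) * L1 + of_real (Im w) * L2) (at x within A)"
    by (intro tendsto_intros L)
  then have "(ddir w u \<longlongrightarrow> of_real (Re w) * L1 + of_real (Im w) * L2) (at x within A)"
    by (rule Lim_transform_eventually) (use ev in eventually_elim, simp add: ddir_components[of u _ w])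
  then show "(ddir w u \<longlongrightarrow> bderiv A w u x) (at x within A)"
    unfolding bderiv_def using tendsto_Lim[OF nt] by metis
qed

lemma has_side_derivative_components:
  assumes "has_side_derivative u G x A" "at x within A \<noteq> bot"
  shows "G w = of_real (Re w) * G 1 + of_real (Im w) * G \<i>"
proof -
  have L: "\<And>w. (ddir w u \<longlongrightarrow> G w) (at x within A)"
    and ev: "eventually (\<lambda>y. u differentiable at y) (at x within A)"
    using assms(1) by (auto simp: has_side_derivative_def)
  have "((\<lambda>y. of_real (Re w) * ddir 1 u y + of_real (Im w) * ddir \<i> u y)
      \<longlongrightarrow> of_real (Re w) * G 1 + of_real (Im w) * G \<i>) (at x within A)"
    by (intro tendsto_intros L)
  then have "(ddir w u \<longlongrightarrow> of_real (Re w) * G 1 + of_real (Im w) * G \<i>) (at x within A)"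
    by (rule Lim_transform_eventually) (use ev in eventually_elim, simp add: ddir_components[of u _ w])
  then show ?thesis using tendsto_unique[OF assms(2) L] by blast
qed

lemma has_side_derivative_diff:
  assumes "has_side_derivative u G x A" "has_side_derivative v F x A"
  shows "has_side_derivative (\<lambda>y. u y - v y) (\<lambda>w. G w - F w) x A"
  unfolding has_side_derivative_def
proof (intro conjI allI)
  have ev: "eventually (\<lambda>y. u differentiable at y) (at x within A)"
    "eventually (\<lambda>y. v differentiable at y) (at x within A)"
    using assms by (auto simp: has_side_derivative_def)
  then show "eventually (\<lambda>y. (\<lambda>y. u y - v y) differentiable at y) (at x within A)"
    by eventually_elim (rule differentiable_diff)
  fix w
  have "((\<lambda>y. ddir w u y - ddir w v y) \<longlongrightarrow> G w - F w) (at x within A)"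
    using assms by (intro tendsto_intros) (auto simp: has_side_derivative_def)
  then show "(ddir w (\<lambda>y. u y - v y) \<longlongrightarrow> G w - F w) (at x within A)"
    by (rule Lim_transform_eventually) (use ev in eventually_elim, simp add: ddir_diff)
qed

lemma has_side_derivative_cmult:
  assumes "has_side_derivative u G x A"
  shows "has_side_derivative (\<lambda>y. c * u y) (\<lambda>w. c * G w) x A"
  unfolding has_side_derivative_def
proof (intro conjI allI)
  have ev: "eventually (\<lambda>y. u differentiable at y) (at x within A)"
    using assms by (auto simp: has_side_derivative_def)
  then show "eventually (\<lambda>y. (\<lambda>y. c * u y) differentiable at y) (at x within A)"
    by eventually_elim (auto intro: differentiable_mult)
  fix w
  have eq: "ddir w (\<lambda>y. c * u y) y = c * ddir w u y" if "u differentiable at y" for y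
    by (rule ddir_eq) (intro derivative_intros ddir_has_derivative that)
  have "((\<lambda>y. c * ddir w u y) \<longlongrightarrow> c * G w) (at x within A)"
    using assms by (intro tendsto_intros) (auto simp: has_side_derivative_def)
  then show "(ddir w (\<lambda>y. c * u y) \<longlongrightarrow> c * G w) (at x within A)"
    by (rule Lim_transform_eventually) (use ev in eventually_elim, simp add: eq)
qed

lemma has_side_derivative_const: "has_side_derivative (\<lambda>y. c) (\<lambda>w. 0) x A"
proof -
  have "ddir w (\<lambda>y. c) y = 0" for w y
    by (rule ddir_eq[of _ "\<lambda>_. 0"]) simp
  then have "ddir w (\<lambda>y. c) = (\<lambda>y. 0)" for w by auto
  then show ?thesis by (simp add: has_side_derivative_def)
qed

lemma has_side_derivative_add:
  assumes "has_side_derivative u G x A" "has_side_derivative v F x A"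
  shows "has_side_derivative (\<lambda>y. u y + v y) (\<lambda>w. G w + F w) x A"
  using has_side_derivative_diff[OF assms(1) has_side_derivative_cmult[OF assms(2), of "-1"]] by simp

lemma has_side_derivative_sum:
  assumes "\<And>i. i \<in> K \<Longrightarrow> has_side_derivative (u i) (G i) x A"
  shows "has_side_derivative (\<lambda>y. \<Sum>i\<in>K. u i y) (\<lambda>w. \<Sum>i\<in>K. G i w) x A"
  using assms
  by (induction K rule: infinite_finite_induct)
     (auto intro: has_side_derivative_const has_side_derivative_add)

lemma has_side_derivative_cong:
  assumes "open A" "\<And>y. y \<in> A \<Longrightarrow> u y = v y" "has_side_derivative u G x A"
  shows "has_side_derivative v G x A"
proof -
  have ev: "eventually (\<lambda>y. u differentiable at y \<and> y \<in> A) (at x within A)"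
    using assms(3) by (auto simp: has_side_derivative_def eventually_at_filter elim: eventually_mono)
  have "(ddir w v \<longlongrightarrow> G w) (at x within A)" for w
  proof (rule Lim_transform_eventually)
    show "(ddir w u \<longlongrightarrow> G w) (at x within A)" using assms(3) by (simp add: has_side_derivative_def)
    show "eventually (\<lambda>y. ddir w u y = ddir w v y) (at x within A)"
      using ev by eventually_elim (metis ddir_cong_open(1) assms(1,2))
  qed
  moreover have "eventually (\<lambda>y. v differentiable at y) (at x within A)"
    using ev by eventually_elim (metis ddir_cong_open(2) assms(1,2))
  ultimately show ?thesis by (simp add: has_side_derivative_def)
qed

lemma has_side_derivative_unique:
  assumes "has_side_derivative u G x A" "has_side_derivative u F x A" "at x within A \<noteq> bot"
  shows "G w = F w"
  using assms tendsto_unique[OF assms(3)] unfolding has_side_derivative_def by blast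

lemma at_within_exterior_neq_bot:
  assumes "norm x = r" "r > 0"
  shows "at x within {y::complex. r < norm y} \<noteq> bot"
proof -
  have "{y::complex. r < norm y} = - cball 0 r" by auto
  then have "x \<in> closure {y. r < norm y}" using assms by (simp add: closure_complement)
  moreover have "x \<notin> {y. r < norm y}" using assms by simp
  ultimately show ?thesis by (simp add: at_within_eq_bot_iff)
qed

lemma at_within_ball_neq_bot:
  assumes "norm x = r" "r > 0"
  shows "at x within ball (0::complex) r \<noteq> bot"
proof -
  have "x \<in> closure (ball 0 r)" using assms by simp
  moreover have "x \<notin> ball 0 r" using assms by simp
  ultimately show ?thesis by (simp add: at_within_eq_bot_iff)
qed

text \<open>An approach from outside becomes one from inside. The filter \<open>at x within\<close>
  is punctured, so the reflected points must also avoid x; they do, having norm less than r.\<close>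

lemma filterlim_circle_reflection:
  assumes r: "r > 0" and x: "norm x = r"
  shows "filterlim (circle_reflection r) (at x within ball 0 r) (at x within {y. r < norm y})"
proof -
  have "x \<noteq> 0" using assms by auto
  then have "(circle_reflection r \<longlongrightarrow> circle_reflection r x) (at x within {y. r < norm y})"
    using has_derivative_continuous[OF circle_reflection_has_derivative]
    by (metis continuous_within tendsto_within_subset subset_UNIV)
  moreover have "eventually (\<lambda>y. circle_reflection r y \<in> ball 0 r \<and> circle_reflection r y \<noteq> x)
      (at x within {y. r < norm y})"
    unfolding eventually_at_filter
    by (rule always_eventually) (use norm_circle_reflection_less[OF r] x in force)
  ultimately show ?thesis by (simp add: filterlim_at circle_reflection_fixed[OF x r])
qed

lemma has_side_derivative_reflection:
  assumes r: "r > 0" and x: "norm x = r" and u: "has_side_derivative u G x (ball 0 r)"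
  shows "has_side_derivative (\<lambda>y. u (circle_reflection r y))
    (\<lambda>w. G (- of_real (r\<^sup>2) * cnj w / (cnj x)\<^sup>2)) x {y. r < norm y}"
  unfolding has_side_derivative_def
proof (intro conjI allI)
  let ?A = "at x within {y. r < norm y}"
  note fl = filterlim_circle_reflection[OF r x]
  have "x \<noteq> 0" using r x by auto
  have nz: "eventually (\<lambda>y. y \<noteq> 0) ?A"
    unfolding eventually_at_filter by (rule always_eventually) (use r in auto)
  have "eventually (\<lambda>y. u differentiable at y) (at x within ball 0 r)"
    using u by (simp add: has_side_derivative_def)
  from eventually_compose_filterlim[OF this fl]
  have ev: "eventually (\<lambda>y. u differentiable at (circle_reflection r y)) ?A" .
  define \<rho>' where "\<rho>' y w = - of_real (r\<^sup>2) * cnj w / (cnj y)\<^sup>2" for y w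
  have D: "((\<lambda>y. u (circle_reflection r y)) has_derivative (\<lambda>w. ddir (\<rho>' y w) u (circle_reflection r y))) (at y)"
    if "u differentiable at (circle_reflection r y)" "y \<noteq> 0" for y
    using has_derivative_compose[OF circle_reflection_has_derivative[OF that(2)] ddir_has_derivative[OF that(1)]]
    by (simp add: \<rho>'_def)
  show "eventually (\<lambda>y. (\<lambda>y. u (circle_reflection r y)) differentiable at y) ?A"
    using ev nz by eventually_elim (use D in \<open>auto simp: differentiable_def\<close>)
  fix w
  have L: "((\<lambda>y. ddir a u (circle_reflection r y)) \<longlongrightarrow> G a) ?A" for a
    using u filterlim_compose[OF _ fl] by (auto simp: has_side_derivative_def)
  \<comment> \<open>The direction \<open>\<rho>' y w\<close> moves with y, while convergence is
    known for fixed directions only; hence the expansion in the directions 1 and i, whose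
    coefficients converge.\<close>
  have "((\<lambda>y. of_real (Re (\<rho>' y w)) * ddir 1 u (circle_reflection r y)
        + of_real (Im (\<rho>' y w)) * ddir \<i> u (circle_reflection r y))
      \<longlongrightarrow> of_real (Re (\<rho>' x w)) * G 1 + of_real (Im (\<rho>' x w)) * G \<i>) ?A"
    unfolding \<rho>'_def using \<open>x \<noteq> 0\<close> by (intro tendsto_intros L) auto
  then have "(ddir w (\<lambda>y. u (circle_reflection r y))
      \<longlongrightarrow> of_real (Re (\<rho>' x w)) * G 1 + of_real (Im (\<rho>' x w)) * G \<i>) ?A"
  proof (rule Lim_transform_eventually)
    show "eventually (\<lambda>y. of_real (Re (\<rho>' y w)) * ddir 1 u (circle_reflection r y)
        + of_real (Im (\<rho>' y w)) * ddir \<i> u (circle_reflection r y)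
        = ddir w (\<lambda>y. u (circle_reflection r y)) y) ?A"
      using ev nz
    proof eventually_elim
      case (elim y)
      show ?case unfolding ddir_eq[OF D[OF elim]] using ddir_components[OF elim(1), of "\<rho>' y w"] by (rule sym)
    qed
  qed
  then show "(ddir w (\<lambda>y. u (circle_reflection r y))
      \<longlongrightarrow> G (- of_real (r\<^sup>2) * cnj w / (cnj x)\<^sup>2)) ?A"
    using has_side_derivative_components[OF u at_within_ball_neq_bot[OF x r], of "\<rho>' x w"]
    by (simp add: \<rho>'_def)
qed

text \<open>\<open>G x\<close> is the derivative at x in the direction x, so \<open>G x = 0\<close>
  is the homogeneous Neumann condition. The real and imaginary parts are handled separately, through
  c = 1 and c = -i.\<close>

lemma loc_harmonic_on_ball_neumann:
  assumes u: "loc_harmonic_on (ball 0 r) u"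
    and G: "\<And>x. norm x = r \<Longrightarrow> \<exists>G. has_side_derivative u G x (ball 0 r) \<and> G x = 0"
    and y: "y \<in> ball 0 r"
  shows "u y = u 0"
proof -
  have r: "r > 0" using y by (simp add: order_le_less_trans[OF norm_ge_zero])
  have "Re (c * u y) = Re (c * u 0)" for c
  proof (rule ball_vanishing_radial_derivative[of r "\<lambda>x. Re (c * u x)"])
    show "locally_Re_holomorphic (ball 0 r) (\<lambda>x. Re (c * u x))"
      using u by (simp add: loc_harmonic_on_def)
    fix x :: complex assume x: "norm x = r"
    obtain G where G: "has_side_derivative u G x (ball 0 r)" "G x = 0" using G[OF x] by blast
    have L: "(ddir w u \<longlongrightarrow> G w) (at x within ball 0 r)" for w
      using G(1) by (simp add: has_side_derivative_def)
    have "((\<lambda>y. Re (c * (of_real (Re y) * ddir 1 u y + of_real (Im y) * ddir \<i> u y)))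
        \<longlongrightarrow> Re (c * (of_real (Re x) * G 1 + of_real (Im x) * G \<i>))) (at x within ball 0 r)"
      by (intro tendsto_intros L)
    moreover have "of_real (Re x) * G 1 + of_real (Im x) * G \<i> = 0"
      using has_side_derivative_components[OF G(1) at_within_ball_neq_bot[OF x r], of x] G(2) by simp
    ultimately have *: "((\<lambda>y. Re (c * (of_real (Re y) * ddir 1 u y + of_real (Im y) * ddir \<i> u y)))
        \<longlongrightarrow> 0) (at x within ball 0 r)" by simp
    have ev: "eventually (\<lambda>y. u differentiable at y) (at x within ball 0 r)"
      using G(1) by (simp add: has_side_derivative_def)
    show "((\<lambda>y. frechet_derivative (\<lambda>x. Re (c * u x)) (at y) y) \<longlongrightarrow> 0) (at x within ball 0 r)"
      using *
    proof (rule Lim_transform_eventually)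
      show "eventually (\<lambda>y. Re (c * (of_real (Re y) * ddir 1 u y + of_real (Im y) * ddir \<i> u y))
          = frechet_derivative (\<lambda>x. Re (c * u x)) (at y) y) (at x within ball 0 r)"
        using ev
      proof eventually_elim
        case (elim y)
        have "((\<lambda>x. Re (c * u x)) has_derivative (\<lambda>h. Re (c * ddir h u y))) (at y)"
          by (intro derivative_intros ddir_has_derivative elim)
        from frechet_derivative_at[OF this] ddir_components[OF elim, of y]
        show ?case by metis
      qed
    qed
  qed (rule y)
  from this[of 1] this[of "- \<i>"] show ?thesis by (simp add: complex_eq_iff)
qed

section \<open>The transmission problem on the disk\<close>

text \<open>In polar coordinates (|x| / r)^k cos(k \<theta>), scaled to be cos(k \<theta>) on the
  circle. Composed with the reflection it is (r / |x|)^k cos(k \<theta>), the decaying mode with the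
  same boundary values.\<close>

definition disk_mode :: "real \<Rightarrow> nat \<Rightarrow> complex \<Rightarrow> complex" where
  "disk_mode r k x = complex_of_real (Re ((x / of_real r) ^ k))"

lemma disk_mode_0 [simp]: "k > 0 \<Longrightarrow> disk_mode r k 0 = 0"
  by (simp add: disk_mode_def)

lemma disk_mode_circle:
  assumes "r > 0"
  shows "disk_mode r k (circle_arclength r s) = of_real (cos (real k * (s / r)))"
  using assms by (simp add: disk_mode_def circle_arclength_def Complex.DeMoivre)

lemma norm_disk_mode_le: "r > 0 \<Longrightarrow> norm (disk_mode r k x) \<le> (norm x / r) ^ k"
  using abs_Re_le_cmod[of "(x / of_real r) ^ k"] by (simp add: disk_mode_def norm_power norm_divide)

lemma continuous_disk_mode: "isCont (disk_mode r k) x"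
  unfolding disk_mode_def[abs_def] divide_inverse
  by (intro isCont_of_real isCont_Re continuous_intros)

lemma loc_harmonic_on_disk_mode: "open S \<Longrightarrow> loc_harmonic_on S (disk_mode r k)"
  unfolding disk_mode_def[abs_def] divide_inverse
  by (intro loc_harmonic_on_of_real_Re holomorphic_intros)

lemma disk_mode_has_derivative:
  "(disk_mode r k has_derivative
     (\<lambda>w. of_real (Re (of_nat k * (x / of_real r) ^ (k - 1) / of_real r * w)))) (at x)"
proof -
  have "((\<lambda>x. (x / of_real r) ^ k) has_field_derivative of_nat k * (x / of_real r) ^ (k - 1) / of_real r) (at x)"
    unfolding divide_inverse by (auto intro!: derivative_eq_intros)
  then have "((\<lambda>x. (x / of_real r) ^ k) has_derivative
      (\<lambda>w. of_nat k * (x / of_real r) ^ (k - 1) / of_real r * w)) (at x)"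
    by (rule has_field_derivative_imp_has_derivative)
  then show ?thesis
    unfolding disk_mode_def[abs_def] by (intro has_derivative_of_real has_derivative_Re)
qed

lemma has_side_derivative_disk_mode:
  "has_side_derivative (disk_mode r k)
     (\<lambda>w. of_real (Re (of_nat k * (x / of_real r) ^ (k - 1) / of_real r * w))) x A"
  unfolding has_side_derivative_def
proof (intro conjI allI)
  show "eventually (\<lambda>y. disk_mode r k differentiable at y) (at x within A)"
    by (rule always_eventually) (metis disk_mode_has_derivative differentiable_def)
  fix w
  have "ddir w (disk_mode r k) = (\<lambda>y. of_real (Re (of_nat k * (y / of_real r) ^ (k - 1) / of_real r * w)))"
    by (rule ext) (rule ddir_eq[OF disk_mode_has_derivative])
  then show "(ddir w (disk_mode r k) \<longlongrightarrow>
      of_real (Re (of_nat k * (x / of_real r) ^ (k - 1) / of_real r * w))) (at x within A)"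
    unfolding divide_inverse by (simp only:) (intro tendsto_intros)
qed

text \<open>Euler's identity for a homogeneous function of degree k. For k = 0 the exponent
  \<open>k - 1\<close> is truncated, but the factor \<open>of_nat k\<close> vanishes.\<close>

lemma disk_mode_radial_derivative:
  "complex_of_real (Re (of_nat k * (x / of_real r) ^ (k - 1) / of_real r * x)) = of_nat k * disk_mode r k x"
proof (cases k)
  case (Suc n)
  have "of_nat k * (x / of_real r) ^ (k - 1) / of_real r * x = of_real (real k) * (x / of_real r) ^ k"
    by (simp add: Suc)
  then show ?thesis unfolding disk_mode_def by (simp del: of_nat_Suc)
qed simp

lemma circle_arclength_surj:
  assumes "norm x = r" "r > 0"
  obtains s where "x = circle_arclength r s"
proof
  show "x = circle_arclength r (r * Arg x)"
    using rcis_cmod_Arg[of x] assms by (simp add: circle_arclength_def rcis_def)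
qed

lemma norm_circle_arclength: "r > 0 \<Longrightarrow> norm (circle_arclength r s) = r"
  by (simp add: circle_arclength_def norm_mult)

lemma outward_normal_circle:
  assumes "r > 0"
  shows "outward_normal (circle_arclength r) s = circle_arclength r s / of_real r"
proof -
  have "(circle_arclength r has_vector_derivative \<i> * cis (s / r)) (at s)"
    unfolding circle_arclength_def[abs_def] cis_conv_exp
    using assms by (auto intro!: derivative_eq_intros has_vector_derivative_real_field simp: field_simps)
  then show ?thesis
    using assms unfolding outward_normal_def unit_tangent_def
    by (simp add: vector_derivative_at circle_arclength_def)
qed

text \<open>The unit normal at x is x / r, so by linearity a normal derivative is a radial
  derivative divided by r. Flux computations can then use the radial form
  \<open>G x\<close>.\<close>

lemma normal_deriv_circle:
  assumes r: "r > 0" and G: "has_side_derivative u G (circle_arclength r s) A"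
    and nt: "at (circle_arclength r s) within A \<noteq> bot"
  shows "normal_deriv A (circle_arclength r) u s = G (circle_arclength r s) / of_real r"
proof -
  let ?x = "circle_arclength r s"
  have "bderiv A w u ?x = G w" for w
    unfolding bderiv_def using tendsto_Lim[OF nt] G by (metis has_side_derivative_def)
  moreover have "G (?x / of_real r) = G ?x / of_real r"
    using has_side_derivative_components[OF G nt, of "?x / of_real r"]
      has_side_derivative_components[OF G nt, of ?x] by (simp add: add_divide_distrib)
  ultimately show ?thesis by (simp add: normal_deriv_def outward_normal_circle[OF r])
qed

lemma bval_tendsto:
  assumes "C1_up_to A B u" "x \<in> B" "at x within A \<noteq> bot"
  shows "(u \<longlongrightarrow> bval A u x) (at x within A)"
  using assms unfolding C1_up_to_def bval_def by (metis tendsto_Lim)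

lemma circle_reflection_at_infinity: "(circle_reflection r \<longlongrightarrow> 0) at_infinity"
proof -
  have "((\<lambda>x. r\<^sup>2 / norm (x::complex)) \<longlongrightarrow> 0) at_infinity"
    by (rule real_tendsto_divide_at_top[OF tendsto_const filterlim_norm_at_top])
  then show ?thesis
    by (simp add: tendsto_norm_zero_iff[of "circle_reflection r", symmetric] norm_circle_reflection)
qed

text \<open>Across the circle the interior field, transplanted by the reflection, differs from the
  exterior one by explicit modes. Since the reflection reverses the radial derivative, the
  jump of the fluxes becomes a Neumann condition for the interior field alone.\<close>

lemma transmission_problem_disk:
  fixes \<kappa> :: "'i \<Rightarrow> nat" and p q b :: "'i \<Rightarrow> complex"
  assumes r: "r > 0" and v: "harmonic_on (- sphere 0 r) v"
    and C1: "C1_up_to (ball 0 r) (sphere 0 r) v" "C1_up_to {x. r < norm x} (sphere 0 r) v"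
    and pos: "\<forall>i\<in>K. \<kappa> i > 0"
    and jump: "\<And>s. bval {x. r < norm x} v (circle_arclength r s) - bval (ball 0 r) v (circle_arclength r s)
        = p0 + (\<Sum>i\<in>K. p i * of_real (cos (real (\<kappa> i) * (s / r))))"
    and flux: "\<And>s. normal_deriv {x. r < norm x} (circle_arclength r) v s
          - eps * normal_deriv (ball 0 r) (circle_arclength r) v s
        = - (\<Sum>i\<in>K. q i * of_real (cos (real (\<kappa> i) * (s / r))))"
    and decay: "((\<lambda>x. v x - (\<Sum>i\<in>K. b i * disk_mode r (\<kappa> i) x)) \<longlongrightarrow> 0) at_infinity"
  shows "\<And>x. r < norm x \<Longrightarrow> v x = (\<Sum>i\<in>K. b i * disk_mode r (\<kappa> i) x)
      + (\<Sum>i\<in>K. (p i - b i) * disk_mode r (\<kappa> i) (circle_reflection r x)) + v (circle_reflection r x) - v 0"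
    and "\<And>x. norm x < r \<Longrightarrow> (1 + eps) * (v x - v 0)
      = (\<Sum>i\<in>K. (of_real r * q i / of_nat (\<kappa> i) + 2 * b i - p i) * disk_mode r (\<kappa> i) x)"
    and "v 0 = - p0"
proof -
  let ?E = "{x::complex. r < norm x}" and ?\<rho> = "circle_reflection r"
  let ?M = "\<lambda>i. disk_mode r (\<kappa> i)"
  have \<kappa>: "\<kappa> i > 0" if "i \<in> K" for i using pos that by blast
  have diff: "v differentiable at x" if "norm x \<noteq> r" for x
    by (rule harmonic_on_differentiable[OF v]) (use that in auto)
  have locE: "loc_harmonic_on ?E v"
    by (intro harmonic_on_imp_loc_harmonic_on harmonic_on_subset[OF v] open_exterior) auto
  have locB: "loc_harmonic_on (ball 0 r) v"
    by (intro harmonic_on_imp_loc_harmonic_on harmonic_on_subset[OF v]) auto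
  \<comment> \<open>On the circle the reflection is the identity, so the coefficients
    \<open>b i\<close> and \<open>p i - b i\<close> add up to \<open>p i\<close> and
    \<open>h\<close> tends to the jump of v minus its prescribed value.\<close>
  define h where "h x = v x - (\<Sum>i\<in>K. b i * ?M i x) - (\<Sum>i\<in>K. (p i - b i) * ?M i (?\<rho> x)) - v (?\<rho> x) - p0" for x
  have h_inf: "(h \<longlongrightarrow> 0 - (\<Sum>i\<in>K. (p i - b i) * ?M i 0) - v 0 - p0) at_infinity"
    unfolding h_def
  proof (intro tendsto_intros decay)
    show "((\<lambda>x. ?M i (?\<rho> x)) \<longlongrightarrow> ?M i 0) at_infinity" for i
      by (rule isCont_tendsto_compose[OF continuous_disk_mode circle_reflection_at_infinity])
    have "isCont v 0" using diff[of 0] r by (intro differentiable_imp_continuous_within) auto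
    then show "((\<lambda>x. v (?\<rho> x)) \<longlongrightarrow> v 0) at_infinity"
      by (rule isCont_tendsto_compose[OF _ circle_reflection_at_infinity])
  qed
  have h0: "h x = 0" if "r < norm x" for x
  proof (rule loc_harmonic_on_exterior_vanish[OF r _ _ h_inf that])
    show "loc_harmonic_on ?E h"
      unfolding h_def
      by (intro loc_harmonic_on_diff locE loc_harmonic_on_sum loc_harmonic_on_cmult loc_harmonic_on_const
          loc_harmonic_on_reflection r locB loc_harmonic_on_disk_mode open_exterior open_ball)
    fix x :: complex assume x: "norm x = r"
    then obtain s where s: "x = circle_arclength r s" using r by (rule circle_arclength_surj)
    have vE: "(v \<longlongrightarrow> bval ?E v x) (at x within ?E)"
      by (rule bval_tendsto[OF C1(2) _ at_within_exterior_neq_bot[OF x r]]) (use x in simp)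
    have vB: "(v \<longlongrightarrow> bval (ball 0 r) v x) (at x within ball 0 r)"
      by (rule bval_tendsto[OF C1(1) _ at_within_ball_neq_bot[OF x r]]) (use x in simp)
    have mE: "(?M i \<longlongrightarrow> ?M i x) (at x within A)" for i A
      by (rule tendsto_within_subset[OF continuous_disk_mode[unfolded isCont_def] subset_UNIV])
    have "(h \<longlongrightarrow> bval ?E v x - (\<Sum>i\<in>K. b i * ?M i x) - (\<Sum>i\<in>K. (p i - b i) * ?M i x)
        - bval (ball 0 r) v x - p0) (at x within ?E)"
      unfolding h_def
      by (intro tendsto_intros vE mE filterlim_compose[OF mE filterlim_circle_reflection[OF r x]]
          filterlim_compose[OF vB filterlim_circle_reflection[OF r x]])
    moreover have "bval ?E v x - (\<Sum>i\<in>K. b i * ?M i x) - (\<Sum>i\<in>K. (p i - b i) * ?M i x)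
        - bval (ball 0 r) v x - p0 = 0"
      using jump[of s] by (simp add: s disk_mode_circle[OF r] sum_subtractf left_diff_distrib algebra_simps)
    ultimately show "(h \<longlongrightarrow> 0) (at x within ?E)" by simp
  qed
  \<comment> \<open>The limit in \<open>h_inf\<close> must be that of the zero function; the modes
    vanish at 0 since their frequencies are positive, which leaves v 0 + p0 = 0.\<close>
  have "eventually (\<lambda>x. h x = 0) at_infinity"
    unfolding eventually_at_infinity by (rule exI[of _ "r + 1"]) (use h0 in auto)
  then have "(h \<longlongrightarrow> 0) at_infinity" by (rule tendsto_eventually)
  from tendsto_unique[OF trivial_limit_at_infinity h_inf this] have "- v 0 = p0"
    using \<kappa> by simp
  then show v0: "v 0 = - p0" by (metis minus_minus)
  have ext: "v x = (\<Sum>i\<in>K. b i * ?M i x) + (\<Sum>i\<in>K. (p i - b i) * ?M i (?\<rho> x)) + v (?\<rho> x) - v 0"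
    if "r < norm x" for x
    using h0[OF that] v0 by (simp add: h_def algebra_simps)
  then show "\<And>x. r < norm x \<Longrightarrow> v x = (\<Sum>i\<in>K. b i * ?M i x)
      + (\<Sum>i\<in>K. (p i - b i) * ?M i (?\<rho> x)) + v (?\<rho> x) - v 0" .
  \<comment> \<open>(1 + eps) times the inner radial derivative will have the coefficients
    \<open>\<kappa> i * (2 * b i - p i) + r * q i\<close>; dividing by \<open>\<kappa> i\<close>,
    the factor gained by radial differentiation of a mode, gives \<open>c i\<close>.\<close>
  define c where "c i = of_real r * q i / of_nat (\<kappa> i) + 2 * b i - p i" for i
  define w where "w x = (1 + eps) * v x - (\<Sum>i\<in>K. c i * ?M i x)" for x
  have w: "w x = w 0" if "norm x < r" for x
  proof (rule loc_harmonic_on_ball_neumann)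
    show "loc_harmonic_on (ball 0 r) w"
      unfolding w_def
      by (intro loc_harmonic_on_diff loc_harmonic_on_sum loc_harmonic_on_cmult locB
          loc_harmonic_on_disk_mode open_ball)
    show "x \<in> ball 0 r" using that by simp
    fix y :: complex assume y: "norm y = r"
    then obtain s where s: "y = circle_arclength r s" using r by (rule circle_arclength_surj)
    define M' where "M' i w = complex_of_real (Re (of_nat (\<kappa> i) * (y / of_real r) ^ (\<kappa> i - 1) / of_real r * w))" for i w
    have M': "has_side_derivative (?M i) (M' i) y A" for i A
      unfolding M'_def by (rule has_side_derivative_disk_mode)
    have M'y: "M' i y = of_nat (\<kappa> i) * ?M i y" for i
      unfolding M'_def by (rule disk_mode_radial_derivative)
    define F where "F w = bderiv ?E w v y" for w
    define G where "G w = bderiv (ball 0 r) w v y" for w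
    note ntE = at_within_exterior_neq_bot[OF y r] and ntB = at_within_ball_neq_bot[OF y r]
    have F: "has_side_derivative v F y ?E"
      unfolding F_def by (rule has_side_derivative_C1[OF C1(2) _ _ ntE]) (use y diff in auto)
    have G: "has_side_derivative v G y (ball 0 r)"
      unfolding G_def by (rule has_side_derivative_C1[OF C1(1) _ _ ntB]) (use y diff in auto)
    \<comment> \<open>\<open>W\<close> collects everything that is reflected: outside, v is an
      unreflected sum plus \<open>W\<close> composed with the reflection, minus the constant v
      0.\<close>
    define W where "W x = v x + (\<Sum>i\<in>K. (p i - b i) * ?M i x)" for x
    define W' where "W' w = G w + (\<Sum>i\<in>K. (p i - b i) * M' i w)" for w
    have W: "has_side_derivative W W' y (ball 0 r)"
      unfolding W_def W'_def
      by (intro has_side_derivative_add has_side_derivative_sum has_side_derivative_cmult G M')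
    define N where "N w = (\<Sum>i\<in>K. b i * M' i w) + W' (- of_real (r\<^sup>2) * cnj w / (cnj y)\<^sup>2) - 0" for w
    have "has_side_derivative (\<lambda>x. (\<Sum>i\<in>K. b i * ?M i x) + W (?\<rho> x) - v 0) N y ?E"
      unfolding N_def
      by (intro has_side_derivative_add has_side_derivative_diff has_side_derivative_const
          has_side_derivative_sum has_side_derivative_cmult M' has_side_derivative_reflection[OF r y W])
    then have "has_side_derivative v N y ?E"
      by (rule has_side_derivative_cong[OF open_exterior, rotated]) (use ext in \<open>simp add: W_def\<close>)
    then have "F y = N y" by (rule has_side_derivative_unique[OF F _ ntE])
    \<comment> \<open>The differential of the reflection sends the radial direction y to -y; this is
      the sign that produces 1 + eps.\<close>
    moreover have "- of_real (r\<^sup>2) * cnj y / (cnj y)\<^sup>2 = - ?\<rho> y"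
      using y r by (auto simp: circle_reflection_def power2_eq_square)
    moreover have "W' (- y) = - W' y"
      using has_side_derivative_components[OF W ntB, of "- y"]
        has_side_derivative_components[OF W ntB, of y] by simp
    ultimately have "F y = (\<Sum>i\<in>K. b i * M' i y) - W' y"
      by (simp add: N_def circle_reflection_fixed[OF y r])
    then have "F y = (\<Sum>i\<in>K. b i * M' i y) - (\<Sum>i\<in>K. (p i - b i) * M' i y) - G y"
      by (simp add: W'_def)
    also have "\<dots> = (\<Sum>i\<in>K. (2 * b i - p i) * (of_nat (\<kappa> i) * ?M i y)) - G y"
      unfolding sum_subtractf[symmetric] by (simp add: M'y algebra_simps)
    finally have Fy: "F y = (\<Sum>i\<in>K. (2 * b i - p i) * (of_nat (\<kappa> i) * ?M i y)) - G y" .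
    have "F y / of_real r - eps * (G y / of_real r) = - (\<Sum>i\<in>K. q i * ?M i y)"
      using flux[of s] normal_deriv_circle[OF r F[unfolded s] ntE[unfolded s]]
        normal_deriv_circle[OF r G[unfolded s] ntB[unfolded s]]
      by (simp add: s disk_mode_circle[OF r])
    then have "F y - eps * G y = - (\<Sum>i\<in>K. of_real r * q i * ?M i y)"
      using r by (simp add: field_simps sum_distrib_left)
    then have "(1 + eps) * G y = (\<Sum>i\<in>K. (2 * b i - p i) * (of_nat (\<kappa> i) * ?M i y))
        + (\<Sum>i\<in>K. of_real r * q i * ?M i y)"
      unfolding Fy by (simp add: algebra_simps)
    also have "\<dots> = (\<Sum>i\<in>K. c i * M' i y)"
      unfolding sum.distrib[symmetric] using \<kappa>
      by (intro sum.cong refl) (simp add: c_def M'y field_simps)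
    finally have "(1 + eps) * G y - (\<Sum>i\<in>K. c i * M' i y) = 0" by simp
    moreover have "has_side_derivative w (\<lambda>z. (1 + eps) * G z - (\<Sum>i\<in>K. c i * M' i z)) y (ball 0 r)"
      unfolding w_def
      by (intro has_side_derivative_diff has_side_derivative_sum has_side_derivative_cmult G M')
    ultimately show "\<exists>G. has_side_derivative w G y (ball 0 r) \<and> G y = 0" by blast
  qed
  \<comment> \<open>Hence w 0 = (1 + eps) v 0, and the constancy of \<open>w\<close> is the claimed
    identity.\<close>
  have "(\<Sum>i\<in>K. c i * ?M i 0) = 0" using \<kappa> by (intro sum.neutral) auto
  then show "(1 + eps) * (v x - v 0)
      = (\<Sum>i\<in>K. (of_real r * q i / of_nat (\<kappa> i) + 2 * b i - p i) * ?M i x)" if "norm x < r" for x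
    using w[OF that] by (simp add: w_def c_def algebra_simps)
qed

section \<open>The second harmonic generation system\<close>

lemma disk_mode_reflection_bound:
  assumes "r > 0" "r < norm x" "n \<le> k"
  shows "norm (disk_mode r k (circle_reflection r x)) \<le> (r / norm x) ^ n"
proof -
  have "norm x > 0" using assms(1,2) by linarith
  then have "norm (circle_reflection r x) / r = r / norm x"
    using assms(1) by (simp add: norm_circle_reflection power2_eq_square field_simps)
  then have "norm (disk_mode r k (circle_reflection r x)) \<le> (r / norm x) ^ k"
    using norm_disk_mode_le[OF assms(1), of k "circle_reflection r x"] by simp
  also have "\<dots> \<le> (r / norm x) ^ n"
    using assms \<open>norm x > 0\<close> by (intro power_decreasing) auto
  finally show ?thesis .
qed

lemma eventually_exterior: "eventually (\<lambda>x::complex. r < norm x) at_infinity"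
  unfolding eventually_at_infinity by (rule exI[of _ "r + 1"]) auto

lemma disk_mode_reflection_bigo:
  assumes "r > 0" "n \<le> k"
  shows "(\<lambda>x. disk_mode r k (circle_reflection r x)) \<in> O[at_infinity](\<lambda>x. complex_of_real (1 / norm x ^ n))"
proof (rule bigoI[of _ "r ^ n"])
  show "eventually (\<lambda>x. norm (disk_mode r k (circle_reflection r x))
      \<le> r ^ n * norm (complex_of_real (1 / norm x ^ n))) at_infinity"
    using eventually_exterior[of r]
    by eventually_elim
       (use disk_mode_reflection_bound[OF assms(1) _ assms(2)] in \<open>simp add: power_divide norm_divide norm_power\<close>)
qed

text \<open>Differentiability at the centre gives |v y - v 0| = O(|y|), and the reflection sends x
  to a point of norm r^2 / |x|. No knowledge of the modes of v enters, so this decay is available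
  for every eps2.\<close>

lemma reflection_bigo:
  assumes "r > 0" "v differentiable at 0"
  shows "(\<lambda>x. v (circle_reflection r x) - v 0) \<in> O[at_infinity](\<lambda>x. complex_of_real (1 / norm x))"
proof -
  obtain v' where v': "(v has_derivative v') (at 0)" using assms(2) by (auto simp: differentiable_def)
  then obtain B where B: "\<And>y. norm (v' y) \<le> norm y * B"
    using bounded_linear.bounded has_derivative_bounded_linear by blast
  obtain d where d: "d > 0" "\<And>y. norm y < d \<Longrightarrow> norm (v y - v 0 - v' y) \<le> norm y"
    using v' unfolding has_derivative_at_alt by (metis diff_zero mult_1 zero_less_one)
  have "eventually (\<lambda>x. norm (circle_reflection r x) < d) at_infinity"
    using tendstoD[OF circle_reflection_at_infinity \<open>d > 0\<close>] by simp
  then have "eventually (\<lambda>x. norm (v (circle_reflection r x) - v 0)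
      \<le> (1 + B) * r\<^sup>2 * norm (complex_of_real (1 / norm x))) at_infinity"
  proof eventually_elim
    case (elim x)
    let ?y = "circle_reflection r x"
    have "norm (v ?y - v 0) \<le> norm (v ?y - v 0 - v' ?y) + norm (v' ?y)"
      using norm_triangle_ineq[of "v ?y - v 0 - v' ?y" "v' ?y"] by simp
    also have "\<dots> \<le> (1 + B) * norm ?y"
      using d(2)[OF elim] B[of ?y] by (simp add: algebra_simps)
    finally show ?case by (simp add: norm_circle_reflection norm_divide)
  qed
  then show ?thesis by (rule bigoI)
qed

lemma cos_has_vector_derivative:
  assumes "r \<noteq> 0"
  shows "((\<lambda>t. complex_of_real (cos (k * (t / r)))) has_vector_derivative of_real (- (k / r) * sin (k * (s / r)))) (at s)"
proof -
  have "((\<lambda>t. cos (k * (t / r))) has_real_derivative - (k / r) * sin (k * (s / r))) (at s)"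
    using assms by (auto intro!: derivative_eq_intros)
  then show ?thesis by (rule has_vector_derivative_of_real)
qed

lemma sin_has_vector_derivative:
  assumes "r \<noteq> 0"
  shows "((\<lambda>t. complex_of_real (sin (k * (t / r)))) has_vector_derivative of_real ((k / r) * cos (k * (s / r)))) (at s)"
proof -
  have "((\<lambda>t. sin (k * (t / r))) has_real_derivative (k / r) * cos (k * (s / r))) (at s)"
    using assms by (auto intro!: derivative_eq_intros)
  then show ?thesis by (rule has_vector_derivative_of_real)
qed

section \<open>Solutions of the system as transmission problems\<close>

lemma disk_shg_solutionD:
  assumes r: "r > 0" and sol: "disk_shg_solution r cp cl H eps1 eps2 u v"
  shows "harmonic_on (- sphere 0 r) u" "harmonic_on (- sphere 0 r) v"
    and "C1_up_to (ball 0 r) (sphere 0 r) u" "C1_up_to {x. r < norm x} (sphere 0 r) u"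
    and "C1_up_to (ball 0 r) (sphere 0 r) v" "C1_up_to {x. r < norm x} (sphere 0 r) v"
    and "\<And>s. bval {x. r < norm x} u (circle_arclength r s) = bval (ball 0 r) u (circle_arclength r s)"
    and "\<And>s. normal_deriv {x. r < norm x} (circle_arclength r) u s
        = eps1 * normal_deriv (ball 0 r) (circle_arclength r) u s"
    and "\<And>s. bval {x. r < norm x} v (circle_arclength r s) - bval (ball 0 r) v (circle_arclength r s)
        = 4 * pi * P_perp (ball 0 r) (circle_arclength r) cp eps1 u s"
    and "\<And>s. normal_deriv {x. r < norm x} (circle_arclength r) v s
        - eps2 * normal_deriv (ball 0 r) (circle_arclength r) v s
        = - 4 * pi * surface_charge (ball 0 r) (circle_arclength r) cl eps1 u s"
    and "((\<lambda>x. u x - H x) \<longlongrightarrow> 0) at_infinity" and "(v \<longlongrightarrow> 0) at_infinity"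
proof -
  have f: "frontier (ball 0 r) = sphere (0::complex) r" using r by simp
  have e: "- closure (ball 0 r) = {x::complex. r < norm x}" using r by auto
  note sol = sol[unfolded disk_shg_solution_def shg_solution_def Let_def f e]
  show "harmonic_on (- sphere 0 r) u" "harmonic_on (- sphere 0 r) v"
    "C1_up_to (ball 0 r) (sphere 0 r) u" "C1_up_to {x. r < norm x} (sphere 0 r) u"
    "C1_up_to (ball 0 r) (sphere 0 r) v" "C1_up_to {x. r < norm x} (sphere 0 r) v"
    "\<And>s. bval {x. r < norm x} u (circle_arclength r s) = bval (ball 0 r) u (circle_arclength r s)"
    "\<And>s. normal_deriv {x. r < norm x} (circle_arclength r) u s
        = eps1 * normal_deriv (ball 0 r) (circle_arclength r) u s"
    "\<And>s. bval {x. r < norm x} v (circle_arclength r s) - bval (ball 0 r) v (circle_arclength r s)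
        = 4 * pi * P_perp (ball 0 r) (circle_arclength r) cp eps1 u s"
    "\<And>s. normal_deriv {x. r < norm x} (circle_arclength r) v s
        - eps2 * normal_deriv (ball 0 r) (circle_arclength r) v s
        = - 4 * pi * surface_charge (ball 0 r) (circle_arclength r) cl eps1 u s"
    using sol by blast+
  have "(\<lambda>x. u x - H x) \<in> O[at_infinity](\<lambda>x. complex_of_real (1 / norm x))" using sol by blast
  moreover have "(\<lambda>x::complex. complex_of_real (1 / norm x)) \<in> o[at_infinity](\<lambda>_. 1)"
  proof (rule smalloI_tendsto)
    have "((\<lambda>x::complex. 1 / norm x) \<longlongrightarrow> 0) at_infinity"
      by (rule real_tendsto_divide_at_top[OF tendsto_const filterlim_norm_at_top])
    from tendsto_of_real[OF this]
    show "((\<lambda>x::complex. complex_of_real (1 / norm x) / 1) \<longlongrightarrow> 0) at_infinity"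
      by (simp only: div_by_1 of_real_0)
  qed simp
  ultimately have "(\<lambda>x. u x - H x) \<in> o[at_infinity](\<lambda>_. 1)"
    by (rule landau_o.big_small_trans)
  from smalloD_tendsto[OF this] show "((\<lambda>x. u x - H x) \<longlongrightarrow> 0) at_infinity" by simp
  have "v \<in> o[at_infinity](\<lambda>_. 1)" using sol by blast
  from smalloD_tendsto[OF this] show "(v \<longlongrightarrow> 0) at_infinity" by simp
qed

text \<open>The fundamental field has zero jump and zero flux data and is driven by the background
  coefficients \<open>b\<close> alone. The factor 1 + eps1 is left undivided so that eps1 = -1 is
  covered and can be refuted.\<close>

lemma disk_shg_fundamental_field:
  fixes \<kappa> :: "'i \<Rightarrow> nat"
  assumes r: "r > 0" and sol: "disk_shg_solution r cp cl (\<lambda>x. \<Sum>i\<in>K. b i * disk_mode r (\<kappa> i) x) eps1 eps2 u v"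
    and \<kappa>: "\<forall>i\<in>K. \<kappa> i > 0" and x: "norm x < r"
  shows "(1 + eps1) * u x = (\<Sum>i\<in>K. 2 * b i * disk_mode r (\<kappa> i) x)"
proof -
  note S = disk_shg_solutionD[OF r sol]
  have jump: "bval {x. r < norm x} u (circle_arclength r s) - bval (ball 0 r) u (circle_arclength r s)
      = 0 + (\<Sum>i\<in>K. 0 * of_real (cos (real (\<kappa> i) * (s / r))))" for s
    using S(7) by simp
  have flux: "normal_deriv {x. r < norm x} (circle_arclength r) u s
      - eps1 * normal_deriv (ball 0 r) (circle_arclength r) u s
      = - (\<Sum>i\<in>K. 0 * of_real (cos (real (\<kappa> i) * (s / r))))" for s
    using S(8) by simp
  note T = transmission_problem_disk(2,3)[OF r S(1,3,4) \<kappa> jump flux S(11)]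
  have "u 0 = 0" using T(2) by simp
  then show ?thesis using T(1)[OF x] by simp
qed

section \<open>Two background modes: sources and second-harmonic field\<close>

locale disk_shg_two_modes =
  fixes r :: real and m l :: nat and bm bl cp cl eps1 eps2 :: complex and u v :: "complex \<Rightarrow> complex"
  assumes r: "r > 0" and m: "m > 0" and l: "l > 0" and ml: "m \<noteq> l"
    and sol: "disk_shg_solution r cp cl (\<lambda>x. bm * disk_mode r m x + bl * disk_mode r l x) eps1 eps2 u v"
begin

lemma fundamental:
  assumes "norm x < r"
  shows "(1 + eps1) * u x = 2 * bm * disk_mode r m x + 2 * bl * disk_mode r l x"
proof -
  have "(\<lambda>x. bm * disk_mode r m x + bl * disk_mode r l x)
      = (\<lambda>x. \<Sum>i\<in>{m, l}. (if i = m then bm else bl) * disk_mode r i x)"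
    using ml by auto
  from disk_shg_fundamental_field[OF r sol[unfolded this] _ assms]
  show ?thesis using ml m l by auto
qed

text \<open>Differentiating a mode of degree m along the radius or along the circle brings out the
  factor m, so both sources are built from \<open>Bm\<close> and \<open>Bl\<close>.\<close>

definition Bm :: complex where "Bm = of_nat m * bm"
definition Bl :: complex where "Bl = of_nat l * bl"
definition D :: nat where "D = rel_sym_degree m l"
text \<open>The factor by which the disk multiplies the background inside; all of the resonance in
  eps1 comes from it.\<close>

definition \<alpha> :: complex where "\<alpha> = 2 / (1 + eps1)"

definition freq :: "nat \<Rightarrow> nat" where "freq i = [2 * m, 2 * l, m + l, D] ! i"
text \<open>A squared cosine contributes with weight 1/2, and the cross term 2 cos cos splits evenly
  into the sum and the difference frequency. The constant part of the squares is kept apart, as the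
  constant jump.\<close>

definition jump_coeff :: "nat \<Rightarrow> complex" where
  "jump_coeff i = 4 * of_real pi * cp * (eps1 * \<alpha> / of_real r)\<^sup>2 * [Bm\<^sup>2 / 2, Bl\<^sup>2 / 2, Bm * Bl, Bm * Bl] ! i"
text \<open>The cross terms of the tangential polarisation combine to sin((m + l) \<theta>), hence
  the entry 0 at the difference frequency. The third power of r comes from two derivatives of the
  field and one of the polarisation.\<close>

definition flux_coeff :: "nat \<Rightarrow> complex" where
  "flux_coeff i = 4 * of_real pi * cl * eps1 * \<alpha>\<^sup>2 / of_real r ^ 3 *
     [of_nat (2 * m) * Bm\<^sup>2, of_nat (2 * l) * Bl\<^sup>2, of_nat (2 * (m + l)) * (Bm * Bl), 0] ! i"

lemma freq_pos: "\<forall>i\<in>{..<4}. freq i > 0"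
  using m l ml by (auto simp: freq_def D_def rel_sym_degree_def less_Suc_eq numeral_eq_Suc)

lemma cos_D: "cos (real D * t) = cos (real m * t - real l * t)"
proof (cases "m \<le> l")
  case True
  then have "real D = real l - real m" by (auto simp: D_def rel_sym_degree_def)
  then have "real D * t = - (real m * t - real l * t)" unfolding \<open>real D = _\<close> by (simp add: left_diff_distrib)
  then show ?thesis by (simp only: cos_minus)
next
  case False
  then have "real D = real m - real l" by (auto simp: D_def rel_sym_degree_def)
  then show ?thesis unfolding \<open>real D = _\<close> by (simp add: left_diff_distrib)
qed

context
  assumes eps1: "eps1 \<noteq> -1"
begin

lemma u_eq:
  assumes "norm x < r"
  shows "u x = \<alpha> * (bm * disk_mode r m x + bl * disk_mode r l x)"
proof -
  have "1 + eps1 \<noteq> 0" using eps1 by (simp add: add_eq_0_iff)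
  then show ?thesis using fundamental[OF assms] by (simp add: \<alpha>_def field_simps)
qed

lemma bval_u:
  "bval (ball 0 r) u (circle_arclength r t)
     = \<alpha> * (bm * of_real (cos (real m * (t / r))) + bl * of_real (cos (real l * (t / r))))"
proof -
  let ?x = "circle_arclength r t"
  have M: "(disk_mode r k \<longlongrightarrow> disk_mode r k ?x) (at ?x within ball 0 r)" for k
    by (rule tendsto_within_subset[OF continuous_disk_mode[unfolded isCont_def] subset_UNIV])
  have "((\<lambda>x. \<alpha> * (bm * disk_mode r m x + bl * disk_mode r l x))
      \<longlongrightarrow> \<alpha> * (bm * disk_mode r m ?x + bl * disk_mode r l ?x)) (at ?x within ball 0 r)"
    by (intro tendsto_intros M)
  then have "(u \<longlongrightarrow> \<alpha> * (bm * disk_mode r m ?x + bl * disk_mode r l ?x)) (at ?x within ball 0 r)"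
    by (rule Lim_transform_eventually) (simp add: eventually_at_filter u_eq)
  then show ?thesis
    unfolding bval_def
    using tendsto_Lim[OF at_within_ball_neq_bot[OF norm_circle_arclength[OF r] r]]
    by (simp add: disk_mode_circle[OF r])
qed

lemma normal_deriv_u:
  "normal_deriv (ball 0 r) (circle_arclength r) u t
     = \<alpha> / of_real r * (Bm * of_real (cos (real m * (t / r))) + Bl * of_real (cos (real l * (t / r))))"
proof -
  let ?x = "circle_arclength r t"
  define M' where "M' k w = complex_of_real (Re (of_nat k * (?x / of_real r) ^ (k - 1) / of_real r * w))" for k w
  have M': "has_side_derivative (disk_mode r k) (M' k) ?x A" for k A
    unfolding M'_def by (rule has_side_derivative_disk_mode)
  have M'x: "M' k ?x = of_nat k * disk_mode r k ?x" for k
    unfolding M'_def by (rule disk_mode_radial_derivative)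
  have "has_side_derivative (\<lambda>x. \<alpha> * (bm * disk_mode r m x + bl * disk_mode r l x))
      (\<lambda>w. \<alpha> * (bm * M' m w + bl * M' l w)) ?x (ball 0 r)"
    by (intro has_side_derivative_add has_side_derivative_cmult M')
  then have "has_side_derivative u (\<lambda>w. \<alpha> * (bm * M' m w + bl * M' l w)) ?x (ball 0 r)"
    by (rule has_side_derivative_cong[OF open_ball, rotated]) (simp add: u_eq)
  from normal_deriv_circle[OF r this at_within_ball_neq_bot[OF norm_circle_arclength[OF r] r]]
  show ?thesis
    by (simp add: M'x disk_mode_circle[OF r] Bm_def Bl_def algebra_simps add_divide_distrib)
qed

text \<open>Product-to-sum formulas. The constant term, the mean of the squares, enters the
  transmission problem only as \<open>p0\<close>, through the interior value at the centre.\<close>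

lemma P_perp_u:
  "4 * pi * P_perp (ball 0 r) (circle_arclength r) cp eps1 u t
     = 2 * of_real pi * cp * (eps1 * \<alpha> / of_real r)\<^sup>2 * (Bm\<^sup>2 + Bl\<^sup>2)
       + (\<Sum>i<4. jump_coeff i * of_real (cos (real (freq i) * (t / r))))"
proof -
  define \<theta> where "\<theta> = t / r"
  define f where "f = Bm * of_real (cos (real m * \<theta>)) + Bl * of_real (cos (real l * \<theta>))"
  have "f\<^sup>2 = Bm\<^sup>2 * of_real (cos (real m * \<theta>) * cos (real m * \<theta>))
      + Bl\<^sup>2 * of_real (cos (real l * \<theta>) * cos (real l * \<theta>))
      + 2 * (Bm * Bl) * of_real (cos (real m * \<theta>) * cos (real l * \<theta>))"
    by (simp add: f_def power2_eq_square algebra_simps)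
  also have "\<dots> = (Bm\<^sup>2 + Bl\<^sup>2) / 2 + Bm\<^sup>2 / 2 * of_real (cos (real (2 * m) * \<theta>))
      + Bl\<^sup>2 / 2 * of_real (cos (real (2 * l) * \<theta>)) + Bm * Bl * of_real (cos (real (m + l) * \<theta>))
      + Bm * Bl * of_real (cos (real D * \<theta>))"
    unfolding cos_times_cos cos_D by (simp add: field_simps)
  finally have f2: "f\<^sup>2 = \<dots>" .
  have "4 * pi * P_perp (ball 0 r) (circle_arclength r) cp eps1 u t
      = 4 * of_real pi * cp * (eps1 * \<alpha> / of_real r)\<^sup>2 * f\<^sup>2"
    unfolding P_perp_def normal_deriv_u \<theta>_def[symmetric] f_def[symmetric]
    by (simp add: power_mult_distrib power_divide)
  then show ?thesis
    unfolding f2 jump_coeff_def freq_def \<theta>_def[symmetric]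
    by (simp add: numeral_eq_Suc lessThan_Suc algebra_simps add_divide_distrib)
qed

lemma P_par_u:
  "P_par (ball 0 r) (circle_arclength r) cl eps1 u t
     = - (cl * eps1 * \<alpha>\<^sup>2 / of_real r ^ 2) *
       (Bm\<^sup>2 * of_real (sin (real (2 * m) * (t / r))) + Bl\<^sup>2 * of_real (sin (real (2 * l) * (t / r)))
        + 2 * (Bm * Bl) * of_real (sin (real (m + l) * (t / r))))"
proof -
  define \<theta> where "\<theta> = t / r"
  define f where "f = Bm * of_real (cos (real m * \<theta>)) + Bl * of_real (cos (real l * \<theta>))"
  define g where "g = Bm * of_real (sin (real m * \<theta>)) + Bl * of_real (sin (real l * \<theta>))"
  have "((\<lambda>t. bval (ball 0 r) u (circle_arclength r t)) has_vector_derivative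
      \<alpha> * (bm * of_real (- (real m / r) * sin (real m * (t / r)))
        + bl * of_real (- (real l / r) * sin (real l * (t / r))))) (at t)"
    unfolding bval_u
    by (intro has_vector_derivative_mult_right has_vector_derivative_add cos_has_vector_derivative less_imp_neq[OF r, symmetric])
  then have "vector_derivative (\<lambda>t. bval (ball 0 r) u (circle_arclength r t)) (at t)
      = - (\<alpha> / of_real r) * g"
    using r by (simp add: vector_derivative_at g_def \<theta>_def Bm_def Bl_def field_simps)
  then have par: "P_par (ball 0 r) (circle_arclength r) cl eps1 u t
      = - (cl * eps1 * \<alpha>\<^sup>2 / of_real r ^ 2) * (2 * (f * g))"
    unfolding P_par_def normal_deriv_u \<theta>_def[symmetric] f_def[symmetric]
    by (simp add: power2_eq_square)
  have fg: "2 * (f * g) = Bm\<^sup>2 * of_real (2 * (sin (real m * \<theta>) * cos (real m * \<theta>)))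
      + Bl\<^sup>2 * of_real (2 * (sin (real l * \<theta>) * cos (real l * \<theta>)))
      + 2 * (Bm * Bl) * of_real (sin (real m * \<theta>) * cos (real l * \<theta>) + cos (real m * \<theta>) * sin (real l * \<theta>))"
    by (simp add: f_def g_def power2_eq_square algebra_simps)
  have dbl: "2 * (sin (real k * \<theta>) * cos (real k * \<theta>)) = sin (real (2 * k) * \<theta>)" for k
    using sin_double[of "real k * \<theta>"] by (simp add: mult.assoc)
  have add: "sin (real m * \<theta>) * cos (real l * \<theta>) + cos (real m * \<theta>) * sin (real l * \<theta>)
      = sin (real (m + l) * \<theta>)"
    by (simp add: sin_add distrib_right)
  show ?thesis unfolding par fg dbl add unfolding \<theta>_def ..
qed

lemma surface_charge_u:
  "- 4 * pi * surface_charge (ball 0 r) (circle_arclength r) cl eps1 u t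
     = - (\<Sum>i<4. flux_coeff i * of_real (cos (real (freq i) * (t / r))))"
proof -
  have "(P_par (ball 0 r) (circle_arclength r) cl eps1 u has_vector_derivative
     - (cl * eps1 * \<alpha>\<^sup>2 / of_real r ^ 2) *
       (Bm\<^sup>2 * of_real (real (2 * m) / r * cos (real (2 * m) * (t / r)))
        + Bl\<^sup>2 * of_real (real (2 * l) / r * cos (real (2 * l) * (t / r)))
        + 2 * (Bm * Bl) * of_real (real (m + l) / r * cos (real (m + l) * (t / r))))) (at t)"
    unfolding P_par_u[abs_def]
    by (intro has_vector_derivative_mult_right has_vector_derivative_add sin_has_vector_derivative less_imp_neq[OF r, symmetric])
  note vd = vector_derivative_at[OF this]
  define C where "C k = complex_of_real (cos (real k * (t / r)))" for k
  have C: "complex_of_real (real k / r * cos (real k * (t / r))) = of_nat k / of_real r * C k" for k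
    by (simp add: C_def)
  show ?thesis
    unfolding surface_charge_def vd C flux_coeff_def freq_def C_def[symmetric] using r
    by (simp add: numeral_eq_Suc lessThan_Suc divide_simps) (simp add: algebra_simps)
qed

text \<open>Dipole decay uses only the exterior field as modes plus the reflected interior field,
  with no division by 1 + eps2. The second identity adds the interior formula.\<close>

lemma second_harmonic_dipole: "v \<in> O[at_infinity](\<lambda>x. complex_of_real (1 / norm x))"
  and second_harmonic:
    "r < norm x \<Longrightarrow> (1 + eps2) * v x
      = (\<Sum>i<4. (eps2 * jump_coeff i + of_real r * flux_coeff i / of_nat (freq i))
          * disk_mode r (freq i) (circle_reflection r x))"
proof -
  note S = disk_shg_solutionD[OF r sol]
  \<comment> \<open>The second-harmonic field has no incident part, so every \<open>b i\<close> is
    0.\<close>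
  have dec: "((\<lambda>x. v x - (\<Sum>i<4. 0 * disk_mode r (freq i) x)) \<longlongrightarrow> 0) at_infinity"
    using S(12) by simp
  note T = transmission_problem_disk[OF r S(2,5,6) freq_pos S(9)[unfolded P_perp_u] S(10)[unfolded surface_charge_u] dec]
  have ext: "v x = (\<Sum>i<4. jump_coeff i * disk_mode r (freq i) (circle_reflection r x))
      + (v (circle_reflection r x) - v 0)" if "r < norm x" for x
    using T(1)[OF that] by simp
  show "(1 + eps2) * v x = (\<Sum>i<4. (eps2 * jump_coeff i + of_real r * flux_coeff i / of_nat (freq i))
          * disk_mode r (freq i) (circle_reflection r x))" if x: "r < norm x" for x
  proof -
    \<comment> \<open>The interior identity is evaluated at the reflected point; (1 + eps2) times
      the jump coefficient minus that coefficient leaves \<open>eps2 * jump_coeff i\<close>.\<close>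
    have "norm (circle_reflection r x) < r" by (rule norm_circle_reflection_less[OF r x])
    from T(2)[OF this] have "(1 + eps2) * v x
        = (1 + eps2) * (\<Sum>i<4. jump_coeff i * disk_mode r (freq i) (circle_reflection r x))
        + (\<Sum>i<4. (of_real r * flux_coeff i / of_nat (freq i) - jump_coeff i)
            * disk_mode r (freq i) (circle_reflection r x))"
      by (subst ext[OF x]) (simp add: distrib_left)
    then show ?thesis
      unfolding sum_distrib_left sum.distrib[symmetric] by (simp add: algebra_simps)
  qed
  have "v differentiable at 0"
    by (rule harmonic_on_differentiable[OF S(2)]) (use r in auto)
  then have "(\<lambda>x. (\<Sum>i<4. jump_coeff i * disk_mode r (freq i) (circle_reflection r x))
      + (v (circle_reflection r x) - v 0)) \<in> O[at_infinity](\<lambda>x. complex_of_real (1 / norm x))"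
  proof (intro sum_in_bigo(1) big_sum_in_bigo reflection_bigo r)
    fix i :: nat assume "i \<in> {..<4}"
    then have "1 \<le> freq i" using freq_pos by (auto simp: Suc_le_eq)
    from disk_mode_reflection_bigo[OF r this]
    have "(\<lambda>x. disk_mode r (freq i) (circle_reflection r x)) \<in> O[at_infinity](\<lambda>x. complex_of_real (1 / norm x))"
      by simp
    then show "(\<lambda>x. jump_coeff i * disk_mode r (freq i) (circle_reflection r x))
        \<in> O[at_infinity](\<lambda>x. complex_of_real (1 / norm x))"
      by (cases "jump_coeff i = 0") simp_all
  qed
  moreover have "eventually (\<lambda>x. v x = (\<Sum>i<4. jump_coeff i * disk_mode r (freq i) (circle_reflection r x))
      + (v (circle_reflection r x) - v 0)) at_infinity"
    using eventually_exterior[of r] by eventually_elim (rule ext)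
  ultimately show "v \<in> O[at_infinity](\<lambda>x. complex_of_real (1 / norm x))"
    by (simp only: landau_o.big.in_cong)
qed

text \<open>Multiplying by (1 + eps1)^2 clears the denominator of \<alpha>^2, whose numerator 4
  turns 4 pi into 16 pi. The frequencies in \<open>flux_coeff\<close> cancel against the division by
  \<open>freq i\<close>, so 2m, 2l and m + l share one factor, while the difference frequency
  carries the normal susceptibility only. With one background coefficient 0, a single
  self-interaction term remains.\<close>

lemma second_harmonic_explicit:
  assumes "r < norm x"
  shows "(1 + eps1)\<^sup>2 * (1 + eps2) * v x = 16 * of_real pi / (of_real r)\<^sup>2 *
    ((eps2 * cp * eps1\<^sup>2 / 2 + cl * eps1) *
       (Bm\<^sup>2 * disk_mode r (2 * m) (circle_reflection r x) + Bl\<^sup>2 * disk_mode r (2 * l) (circle_reflection r x)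
        + 2 * (Bm * Bl) * disk_mode r (m + l) (circle_reflection r x))
     + eps2 * cp * eps1\<^sup>2 * (Bm * Bl) * disk_mode r D (circle_reflection r x))"
proof -
  have e: "1 + eps1 \<noteq> 0" using eps1 by (simp add: add_eq_0_iff)
  let ?E = "\<lambda>k. disk_mode r k (circle_reflection r x)"
  have c: "eps2 * jump_coeff i + of_real r * flux_coeff i / of_nat (freq i)
      = 16 * of_real pi / (of_real r)\<^sup>2 / (1 + eps1)\<^sup>2 *
        [(eps2 * cp * eps1\<^sup>2 / 2 + cl * eps1) * Bm\<^sup>2, (eps2 * cp * eps1\<^sup>2 / 2 + cl * eps1) * Bl\<^sup>2,
         (eps2 * cp * eps1\<^sup>2 / 2 + cl * eps1) * (2 * (Bm * Bl)), eps2 * cp * eps1\<^sup>2 * (Bm * Bl)] ! i"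
    if "i < 4" for i
  proof -
    have "i = 0 \<or> i = 1 \<or> i = 2 \<or> i = 3" using that by linarith
    moreover have "of_nat m + of_nat l \<noteq> (0::complex)" using m by (simp flip: of_nat_add)
    ultimately show ?thesis
      using e r m l unfolding jump_coeff_def flux_coeff_def freq_def \<alpha>_def
      by (elim disjE) (simp_all add: power_divide power_mult_distrib eval_nat_numeral divide_simps, simp_all add: algebra_simps)
  qed
  have "(1 + eps1)\<^sup>2 * (1 + eps2) * v x = (1 + eps1)\<^sup>2 * ((1 + eps2) * v x)" by simp
  also have "\<dots> = 16 * of_real pi / (of_real r)\<^sup>2 *
    (\<Sum>i<4. [(eps2 * cp * eps1\<^sup>2 / 2 + cl * eps1) * Bm\<^sup>2, (eps2 * cp * eps1\<^sup>2 / 2 + cl * eps1) * Bl\<^sup>2,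
         (eps2 * cp * eps1\<^sup>2 / 2 + cl * eps1) * (2 * (Bm * Bl)), eps2 * cp * eps1\<^sup>2 * (Bm * Bl)] ! i * ?E (freq i))"
    unfolding second_harmonic[OF assms] sum_distrib_left
    by (intro sum.cong refl) (use e c in simp)
  finally show ?thesis
    unfolding freq_def by (simp add: numeral_eq_Suc lessThan_Suc algebra_simps)
qed

end

end

text \<open>The constant must not depend on the permittivities, since in the joint limit both vary.
  Their sizes are isolated in the last factor, which dominates |eps2| |eps1|^2 as well as
  |eps1|.\<close>

lemma (in disk_shg_two_modes) second_harmonic_bound:
  assumes "eps1 \<noteq> -1" "r < norm x"
  shows "norm ((1 + eps1)\<^sup>2 * (1 + eps2) * v x)
    \<le> 16 * pi / r\<^sup>2 * ((norm cp + norm cl) * (norm Bm + norm Bl)\<^sup>2 * 2)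
        * ((1 + norm eps1)\<^sup>2 * (1 + norm eps2))"
proof -
  let ?E = "\<lambda>k. disk_mode r k (circle_reflection r x)"
  define a where "a = norm eps1"
  define b where "b = norm eps2"
  define N where "N = (norm Bm + norm Bl)\<^sup>2"
  define T where "T = (1 + a)\<^sup>2 * (1 + b)"
  have ab: "a \<ge> 0" "b \<ge> 0" by (simp_all add: a_def b_def)
  \<comment> \<open>The case n = 0 of the mode bound: reflected modes have modulus at most 1 on the
    whole exterior, so the estimate is uniform up to the circle.\<close>
  have E: "norm (c * ?E k) \<le> norm c" for c k
    using disk_mode_reflection_bound[OF r assms(2), of 0 k] mult_left_mono[of "norm (?E k)" 1 "norm c"]
    by (simp add: norm_mult)
  have T: "b * a\<^sup>2 \<le> T" "a \<le> T"
  proof -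
    have "0 \<le> a * b" "0 \<le> a\<^sup>2 * b" "0 \<le> a\<^sup>2" using ab by simp_all
    moreover have "T = 1 + 2 * a + a\<^sup>2 + b + 2 * (a * b) + a\<^sup>2 * b"
      by (simp add: T_def power2_eq_square algebra_simps)
    ultimately show "b * a\<^sup>2 \<le> T" "a \<le> T" using ab by (simp_all add: mult.commute)
  qed
  have "norm (Bm\<^sup>2 * ?E (2 * m) + Bl\<^sup>2 * ?E (2 * l) + 2 * (Bm * Bl) * ?E (m + l))
      \<le> norm (Bm\<^sup>2) + norm (Bl\<^sup>2) + norm (2 * (Bm * Bl))"
    by (intro norm_triangle_mono E)
  also have "\<dots> = N"
    by (simp add: N_def norm_mult norm_power power2_eq_square algebra_simps)
  finally have 1: "norm (Bm\<^sup>2 * ?E (2 * m) + Bl\<^sup>2 * ?E (2 * l) + 2 * (Bm * Bl) * ?E (m + l)) \<le> N" .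
  have "norm (eps2 * cp * eps1\<^sup>2 / 2 + cl * eps1) \<le> norm cp * (b * a\<^sup>2) + norm cl * a"
  proof -
    have "norm (eps2 * cp * eps1\<^sup>2 / 2) = norm cp * (b * a\<^sup>2) / 2"
      by (simp add: norm_mult norm_divide norm_power a_def b_def)
    moreover have "0 \<le> norm cp * (b * a\<^sup>2)" using ab by simp
    moreover have "norm (cl * eps1) = norm cl * a" by (simp add: norm_mult a_def)
    ultimately show ?thesis
      using norm_triangle_ineq[of "eps2 * cp * eps1\<^sup>2 / 2" "cl * eps1"] by linarith
  qed
  also have "\<dots> \<le> norm cp * T + norm cl * T"
    by (intro add_mono mult_left_mono T) auto
  finally have 2: "norm (eps2 * cp * eps1\<^sup>2 / 2 + cl * eps1) \<le> (norm cp + norm cl) * T"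
    by (simp add: algebra_simps)
  have "norm (Bm * Bl) \<le> N"
    by (simp add: N_def norm_mult power2_eq_square algebra_simps)
  moreover have "norm (eps2 * cp * eps1\<^sup>2) \<le> (norm cp + norm cl) * T"
  proof -
    have "norm (eps2 * cp * eps1\<^sup>2) = norm cp * (b * a\<^sup>2)"
      by (simp add: norm_mult norm_power a_def b_def)
    also have "\<dots> \<le> (norm cp + norm cl) * T"
      using T(1) ab by (intro mult_mono) auto
    finally show ?thesis .
  qed
  ultimately have "norm (eps2 * cp * eps1\<^sup>2 * (Bm * Bl)) \<le> (norm cp + norm cl) * T * N"
    unfolding norm_mult[of _ "Bm * Bl"] by (intro mult_mono) (auto intro: order_trans[OF norm_ge_zero])
  then have 3: "norm (eps2 * cp * eps1\<^sup>2 * (Bm * Bl) * ?E D) \<le> (norm cp + norm cl) * T * N"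
    using E order_trans by blast
  have 4: "norm ((eps2 * cp * eps1\<^sup>2 / 2 + cl * eps1) *
      (Bm\<^sup>2 * ?E (2 * m) + Bl\<^sup>2 * ?E (2 * l) + 2 * (Bm * Bl) * ?E (m + l))) \<le> (norm cp + norm cl) * T * N"
    unfolding norm_mult[of "eps2 * cp * eps1\<^sup>2 / 2 + cl * eps1"] using 1 2
    by (intro mult_mono) (auto intro: order_trans[OF norm_ge_zero])
  have "norm ((1 + eps1)\<^sup>2 * (1 + eps2) * v x)
      \<le> 16 * pi / r\<^sup>2 * ((norm cp + norm cl) * T * N + (norm cp + norm cl) * T * N)"
    unfolding second_harmonic_explicit[OF assms] norm_mult[of "16 * of_real pi / (of_real r)\<^sup>2"]
    using norm_triangle_mono[OF 4 3] by (intro mult_mono) (auto simp: norm_divide norm_mult norm_power)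
  also have "\<dots> = 16 * pi / r\<^sup>2 * ((norm cp + norm cl) * N * 2) * T" by (simp add: field_simps)
  finally show ?thesis by (simp only: T_def N_def a_def b_def)
qed

section \<open>The polar backgrounds, exclusion of eps1 = -1, and uniform bounds\<close>

lemma mode_field_eq:
  assumes "r > 0" "k > 0"
  shows "norm x ^ k * cos (real k * Arg x) = r ^ k * Re ((x / of_real r) ^ k)"
proof -
  have "Re (x ^ k) = norm x ^ k * cos (real k * Arg x)"
    by (subst rcis_cmod_Arg[of x, symmetric], subst DeMoivre2) simp
  moreover have "Re ((x / of_real r) ^ k) = Re (x ^ k) / r ^ k"
    by (simp add: power_divide flip: of_real_power)
  ultimately show ?thesis using assms(1) by simp
qed

lemma two_mode_field_eq:
  assumes "r > 0" "m > 0" "l > 0"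
  shows "two_mode_field E m l = (\<lambda>x. of_real (- E * r ^ m) * disk_mode r m x + of_real (- E * r ^ l) * disk_mode r l x)"
  using mode_field_eq[OF assms(1,2)] mode_field_eq[OF assms(1,3)]
  by (intro ext) (simp add: two_mode_field_def disk_mode_def algebra_simps flip: of_real_mult of_real_add)

text \<open>The term with coefficient 0 makes a single mode an instance of the two-mode
  setting.\<close>

lemma mode_field_eq_two_modes:
  assumes "r > 0" "m > 0"
  shows "mode_field E m = (\<lambda>x. of_real (- E * r ^ m) * disk_mode r m x + 0 * disk_mode r l x)"
  using mode_field_eq[OF assms]
  by (intro ext) (simp add: mode_field_def disk_mode_def algebra_simps flip: of_real_mult of_real_add)

text \<open>At eps1 = -1 the identity for (1 + eps1) u would force the background to vanish in the
  disk. It does not vanish at r / 2, where both modes are positive powers of 1/2 and their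
  coefficients have the same sign because E > 0.\<close>

lemma two_mode_field_solvable:
  assumes r: "r > 0" and "E > 0" "m > 0" "l > 0" "m \<noteq> l"
    and sol: "disk_shg_solution r cp cl (two_mode_field E m l) eps1 eps2 u v"
  shows "disk_shg_two_modes r m l (of_real (- E * r ^ m)) (of_real (- E * r ^ l)) cp cl eps1 eps2 u v"
    and "eps1 \<noteq> -1"
proof -
  show S: "disk_shg_two_modes r m l (of_real (- E * r ^ m)) (of_real (- E * r ^ l)) cp cl eps1 eps2 u v"
    using assms two_mode_field_eq[of r m l E] by unfold_locales simp_all
  show "eps1 \<noteq> -1"
  proof
    assume "eps1 = -1"
    have "norm (complex_of_real (r / 2)) < r" using r by simp
    have M: "disk_mode r k (complex_of_real (r / 2)) = of_real ((1 / 2) ^ k)" for k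
      using r by (simp add: disk_mode_def flip: of_real_divide of_real_power)
    have "2 * complex_of_real (- E * r ^ m) * of_real ((1 / 2) ^ m) + 2 * of_real (- E * r ^ l) * of_real ((1 / 2) ^ l) = 0"
      using disk_shg_two_modes.fundamental[OF S \<open>norm (complex_of_real (r / 2)) < r\<close>]
      unfolding \<open>eps1 = -1\<close> M by (metis add.right_inverse mult_zero_left)
    then have "complex_of_real (2 * (- E * r ^ m) * (1 / 2) ^ m + 2 * (- E * r ^ l) * (1 / 2) ^ l) = 0"
      by (simp only: of_real_add of_real_mult of_real_numeral)
    then have "2 * (- E * r ^ m) * (1 / 2) ^ m + 2 * (- E * r ^ l) * (1 / 2) ^ l = 0"
      by (simp only: of_real_eq_0_iff)
    then have "E * r ^ m * (1 / 2) ^ m + E * r ^ l * (1 / 2) ^ l = 0"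
      by linarith
    moreover have "E * r ^ m * (1 / 2) ^ m + E * r ^ l * (1 / 2) ^ l > 0"
      using r \<open>E > 0\<close> by (intro add_pos_pos) auto
    ultimately show False by simp
  qed
qed

lemma two_mode_second_harmonic_bound:
  assumes r: "r > 0" and "E > 0" "m > 0" "l > 0" "m \<noteq> l"
  obtains C where "C \<ge> 0" "\<And>eps1 eps2 v x. v \<in> second_harmonic_fields r cp cl (two_mode_field E m l) eps1 eps2 \<Longrightarrow>
    r < norm x \<Longrightarrow> eps1 \<noteq> -1 \<Longrightarrow> eps2 \<noteq> -1 \<Longrightarrow>
    norm (v x) \<le> C * ((1 + norm eps1)\<^sup>2 * (1 + norm eps2)) * norm (1 / ((1 + eps1)\<^sup>2 * (1 + eps2)))"
proof -
  define B where "B k = of_nat k * complex_of_real (- E * r ^ k)" for k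
  define C where "C = 16 * pi / r\<^sup>2 * ((norm cp + norm cl) * (norm (B m) + norm (B l))\<^sup>2 * 2)"
  have "C \<ge> 0" unfolding C_def by simp
  moreover have "norm (v x) \<le> C * ((1 + norm eps1)\<^sup>2 * (1 + norm eps2)) * norm (1 / ((1 + eps1)\<^sup>2 * (1 + eps2)))"
    if v: "v \<in> second_harmonic_fields r cp cl (two_mode_field E m l) eps1 eps2"
      and x: "r < norm x" and e: "eps1 \<noteq> -1" "eps2 \<noteq> -1" for eps1 eps2 v x
  proof -
    obtain u where "disk_shg_solution r cp cl (two_mode_field E m l) eps1 eps2 u v"
      using v by (auto simp: second_harmonic_fields_def)
    from two_mode_field_solvable(1)[OF assms this]
    interpret disk_shg_two_modes r m l "of_real (- E * r ^ m)" "of_real (- E * r ^ l)" cp cl eps1 eps2 u v .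
    have *: "norm ((1 + eps1)\<^sup>2 * (1 + eps2) * v x) \<le> C * ((1 + norm eps1)\<^sup>2 * (1 + norm eps2))"
      using second_harmonic_bound[OF e(1) x] unfolding C_def B_def Bm_def Bl_def .
    have nz: "(1 + eps1)\<^sup>2 * (1 + eps2) \<noteq> 0" using e by (simp add: add_eq_0_iff)
    then have "norm (v x) = norm ((1 + eps1)\<^sup>2 * (1 + eps2) * v x) * norm (1 / ((1 + eps1)\<^sup>2 * (1 + eps2)))"
      by (simp flip: norm_mult)
    also have "\<dots> \<le> C * ((1 + norm eps1)\<^sup>2 * (1 + norm eps2)) * norm (1 / ((1 + eps1)\<^sup>2 * (1 + eps2)))"
      by (intro mult_right_mono * norm_ge_zero)
    finally show ?thesis .
  qed
  ultimately show ?thesis using that by blast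
qed

text \<open>The bound 2 is the origin of the factors 3 = 1 + 2 and 9 = 3^2 in the resonance
  constants.\<close>

lemma eventually_near_minus_one: "eventually (\<lambda>e::complex. e \<noteq> -1 \<and> norm e \<le> 2) (at (-1))"
proof -
  have "((\<lambda>e::complex. norm e) \<longlongrightarrow> norm (-1::complex)) (at (-1))" by (intro tendsto_intros)
  then have "eventually (\<lambda>e::complex. norm e < 2) (at (-1))"
    by (rule order_tendstoD) simp
  moreover have "eventually (\<lambda>e::complex. e \<noteq> -1) (at (-1))"
    by (simp add: eventually_at_filter)
  ultimately show ?thesis by eventually_elim simp
qed

text \<open>A mode of frequency k decays like |x|^(-k), so the self-interaction modes 2m and 2l are
  both O(|x|^(-n)) exactly when n <= 2 min(m, l); this is the condition on v itself. Without it the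
  fields of the two single-mode backgrounds are subtracted, which leaves the frequencies m + l >= n
  and n. The multipole part is read off from a formula for (1 + eps2) v, hence eps2 \<noteq> -1
  there. The resonance bounds hold for all second-harmonic fields at once and on the whole exterior
  of the disk.\<close>

theorem theorem6p1:
  fixes r0 E :: real and l m :: nat and chi_perp chi_par :: complex
  assumes "r0 > 0" and "E > 0" and "l \<ge> 2" and "m \<ge> 1" and "m \<noteq> l"
  shows
    "(\<forall>eps1 eps2 u v.
        disk_shg_solution r0 chi_perp chi_par (two_mode_field E m l) eps1 eps2 u v \<longrightarrow>
          (rel_sym_degree m l = 1 \<longrightarrow> dipole_radiation v) \<and>
          (\<forall>n. rel_sym_degree m l = n \<and> eps2 \<noteq> -1 \<longrightarrow>
             (n \<le> 2 * min m l \<longrightarrow> multipole_radiation n v) \<and>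
             (\<forall>u\<^sub>m v\<^sub>m u\<^sub>l v\<^sub>l.
                disk_shg_solution r0 chi_perp chi_par (mode_field E m) eps1 eps2 u\<^sub>m v\<^sub>m \<and>
                disk_shg_solution r0 chi_perp chi_par (mode_field E l) eps1 eps2 u\<^sub>l v\<^sub>l \<longrightarrow>
                  multipole_radiation n (\<lambda>x. v x - v\<^sub>m x - v\<^sub>l x))))
     \<and> (\<forall>eps2. eps2 \<noteq> -1 \<longrightarrow>
          resonance_order {x. r0 < norm x} (at (-1))
            (\<lambda>eps1. second_harmonic_fields r0 chi_perp chi_par (two_mode_field E m l) eps1 eps2)
            (\<lambda>eps1. 1 / (1 + eps1)\<^sup>2))
     \<and> (\<forall>eps1. eps1 \<noteq> -1 \<longrightarrow>
          resonance_order {x. r0 < norm x} (at (-1))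
            (\<lambda>eps2. second_harmonic_fields r0 chi_perp chi_par (two_mode_field E m l) eps1 eps2)
            (\<lambda>eps2. 1 / (1 + eps2)))
     \<and> resonance_order {x. r0 < norm x} (at (-1) \<times>\<^sub>F at (-1))
          (\<lambda>(eps1, eps2). second_harmonic_fields r0 chi_perp chi_par (two_mode_field E m l) eps1 eps2)
          (\<lambda>(eps1, eps2). 1 / ((1 + eps1)\<^sup>2 * (1 + eps2)))"
proof -
  note r = \<open>r0 > 0\<close>
  have ml: "m > 0" "l > 0" using assms by auto
  note hyps = r \<open>E > 0\<close> ml \<open>m \<noteq> l\<close>
  let ?E = "{x::complex. r0 < norm x}"
  let ?V = "second_harmonic_fields r0 chi_perp chi_par (two_mode_field E m l)"
  let ?n = "rel_sym_degree m l"
  have radiation: "(?n = 1 \<longrightarrow> dipole_radiation v) \<and>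
      (eps2 \<noteq> -1 \<longrightarrow> (?n \<le> 2 * min m l \<longrightarrow> multipole_radiation ?n v) \<and>
         (\<forall>u\<^sub>m v\<^sub>m u\<^sub>l v\<^sub>l.
            disk_shg_solution r0 chi_perp chi_par (mode_field E m) eps1 eps2 u\<^sub>m v\<^sub>m \<and>
            disk_shg_solution r0 chi_perp chi_par (mode_field E l) eps1 eps2 u\<^sub>l v\<^sub>l \<longrightarrow>
              multipole_radiation ?n (\<lambda>x. v x - v\<^sub>m x - v\<^sub>l x)))"
    if sol: "disk_shg_solution r0 chi_perp chi_par (two_mode_field E m l) eps1 eps2 u v" for eps1 eps2 u v
  proof -
    note e1 = two_mode_field_solvable(2)[OF hyps sol]
    interpret A: disk_shg_two_modes r0 m l "of_real (- E * r0 ^ m)" "of_real (- E * r0 ^ l)" chi_perp chi_par eps1 eps2 u v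
      by (rule two_mode_field_solvable(1)[OF hyps sol])
    have harm: "harmonic_on ?E w"
      if "disk_shg_solution r0 chi_perp chi_par H eps1 eps2 u' w" for H u' w
      using disk_shg_solutionD(2)[OF r that] by (rule harmonic_on_subset[OF _ open_exterior]) auto
    let ?L = "O[at_infinity](\<lambda>x::complex. complex_of_real (1 / norm x ^ ?n))"
    have M: "(\<lambda>x. c * disk_mode r0 k (circle_reflection r0 x)) \<in> ?L" if "?n \<le> k" for c k
      using disk_mode_reflection_bigo[OF r that] by (cases "c = 0") simp_all
    have dipole: "dipole_radiation v"
      unfolding dipole_radiation_def using harm[OF sol] A.second_harmonic_dipole[OF e1] by blast
    have multipole: "multipole_radiation ?n v" if e2: "eps2 \<noteq> -1" and n: "?n \<le> 2 * min m l"
      unfolding multipole_radiation_def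
    proof (intro conjI exI)
      show "harmonic_on ?E v" by (rule harm[OF sol])
      define a where "a = eps2 * chi_perp * eps1\<^sup>2 / 2 + chi_par * eps1"
      define k where "k = 16 * complex_of_real pi / (of_real r0)\<^sup>2"
      have "(1 + eps1)\<^sup>2 * (1 + eps2) * v x
          = k * (a * A.Bm\<^sup>2) * disk_mode r0 (2 * m) (circle_reflection r0 x)
            + k * (a * A.Bl\<^sup>2) * disk_mode r0 (2 * l) (circle_reflection r0 x)
            + k * (a * (2 * (A.Bm * A.Bl))) * disk_mode r0 (m + l) (circle_reflection r0 x)
            + k * (eps2 * chi_perp * eps1\<^sup>2 * (A.Bm * A.Bl)) * disk_mode r0 A.D (circle_reflection r0 x)"
        if "r0 < norm x" for x
        unfolding A.second_harmonic_explicit[OF e1 that] a_def[symmetric] k_def[symmetric]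
        by (simp add: algebra_simps)
      then have ev: "eventually (\<lambda>x. (1 + eps1)\<^sup>2 * (1 + eps2) * v x
          = k * (a * A.Bm\<^sup>2) * disk_mode r0 (2 * m) (circle_reflection r0 x)
            + k * (a * A.Bl\<^sup>2) * disk_mode r0 (2 * l) (circle_reflection r0 x)
            + k * (a * (2 * (A.Bm * A.Bl))) * disk_mode r0 (m + l) (circle_reflection r0 x)
            + k * (eps2 * chi_perp * eps1\<^sup>2 * (A.Bm * A.Bl)) * disk_mode r0 A.D (circle_reflection r0 x)) at_infinity"
        by (rule eventually_mono[OF eventually_exterior])
      \<comment> \<open>By the bound on the degree, none of the four frequencies is below
        it.\<close>
      have "(\<lambda>x. (1 + eps1)\<^sup>2 * (1 + eps2) * v x) \<in> ?L"
        unfolding landau_o.big.in_cong[OF ev]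
        by (intro sum_in_bigo(1) M) (use n in \<open>auto simp: A.D_def rel_sym_degree_def\<close>)
      moreover have "(1 + eps1)\<^sup>2 * (1 + eps2) \<noteq> 0" using e1 e2 by (simp add: add_eq_0_iff)
      ultimately show "v \<in> ?L" by simp
    qed
    have "multipole_radiation ?n (\<lambda>x. v x - v\<^sub>m x - v\<^sub>l x)"
      if e2: "eps2 \<noteq> -1"
        and solm: "disk_shg_solution r0 chi_perp chi_par (mode_field E m) eps1 eps2 u\<^sub>m v\<^sub>m"
        and soll: "disk_shg_solution r0 chi_perp chi_par (mode_field E l) eps1 eps2 u\<^sub>l v\<^sub>l" for u\<^sub>m v\<^sub>m u\<^sub>l v\<^sub>l
      unfolding multipole_radiation_def
    proof (intro conjI exI)
      show "harmonic_on ?E (\<lambda>x. v x - v\<^sub>m x - v\<^sub>l x)"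
        by (intro harmonic_on_diff harm[OF sol] harm[OF solm] harm[OF soll])
      interpret M: disk_shg_two_modes r0 m l "of_real (- E * r0 ^ m)" 0 chi_perp chi_par eps1 eps2 u\<^sub>m v\<^sub>m
        using r ml(1) ml(2) \<open>m \<noteq> l\<close> solm[unfolded mode_field_eq_two_modes[OF r ml(1), of E l]]
        by (rule disk_shg_two_modes.intro)
      \<comment> \<open>The roles of m and l are exchanged, so the nonzero coefficient of this
        instance is \<open>L.Bm\<close>, which is \<open>A.Bl\<close>.\<close>
      interpret L: disk_shg_two_modes r0 l m "of_real (- E * r0 ^ l)" 0 chi_perp chi_par eps1 eps2 u\<^sub>l v\<^sub>l
        using r ml(2) ml(1) \<open>m \<noteq> l\<close>[symmetric] soll[unfolded mode_field_eq_two_modes[OF r ml(2), of E m]]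
        by (rule disk_shg_two_modes.intro)
      have B: "M.Bl = 0" "L.Bl = 0" "L.Bm = A.Bl"
        by (simp_all only: M.Bl_def L.Bl_def L.Bm_def A.Bl_def mult_zero_right)
      define a where "a = eps2 * chi_perp * eps1\<^sup>2 / 2 + chi_par * eps1"
      define k where "k = 16 * complex_of_real pi / (of_real r0)\<^sup>2"
      \<comment> \<open>The self-interaction terms cancel exactly; only the cross terms,
        proportional to \<open>A.Bm * A.Bl\<close>, survive.\<close>
      have "(1 + eps1)\<^sup>2 * (1 + eps2) * (v x - v\<^sub>m x - v\<^sub>l x)
          = k * (a * (2 * (A.Bm * A.Bl))) * disk_mode r0 (m + l) (circle_reflection r0 x)
            + k * (eps2 * chi_perp * eps1\<^sup>2 * (A.Bm * A.Bl)) * disk_mode r0 A.D (circle_reflection r0 x)"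
        if "r0 < norm x" for x
        unfolding right_diff_distrib A.second_harmonic_explicit[OF e1 that] M.second_harmonic_explicit[OF e1 that]
          L.second_harmonic_explicit[OF e1 that] B a_def[symmetric] k_def[symmetric]
        by (simp add: algebra_simps)
      then have ev: "eventually (\<lambda>x. (1 + eps1)\<^sup>2 * (1 + eps2) * (v x - v\<^sub>m x - v\<^sub>l x)
          = k * (a * (2 * (A.Bm * A.Bl))) * disk_mode r0 (m + l) (circle_reflection r0 x)
            + k * (eps2 * chi_perp * eps1\<^sup>2 * (A.Bm * A.Bl)) * disk_mode r0 A.D (circle_reflection r0 x)) at_infinity"
        by (rule eventually_mono[OF eventually_exterior])
      have "(\<lambda>x. (1 + eps1)\<^sup>2 * (1 + eps2) * (v x - v\<^sub>m x - v\<^sub>l x)) \<in> ?L"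
        unfolding landau_o.big.in_cong[OF ev]
        by (intro sum_in_bigo(1) M) (auto simp: A.D_def rel_sym_degree_def)
      moreover have "(1 + eps1)\<^sup>2 * (1 + eps2) \<noteq> 0" using e1 e2 by (simp add: add_eq_0_iff)
      ultimately show "(\<lambda>x. v x - v\<^sub>m x - v\<^sub>l x) \<in> ?L" by simp
    qed
    with dipole multipole show ?thesis by blast
  qed
  obtain C where C: "C \<ge> 0" "\<And>eps1 eps2 v x. v \<in> ?V eps1 eps2 \<Longrightarrow>
    r0 < norm x \<Longrightarrow> eps1 \<noteq> -1 \<Longrightarrow> eps2 \<noteq> -1 \<Longrightarrow>
    norm (v x) \<le> C * ((1 + norm eps1)\<^sup>2 * (1 + norm eps2)) * norm (1 / ((1 + eps1)\<^sup>2 * (1 + eps2)))"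
    using two_mode_second_harmonic_bound[OF hyps] by metis
  have near: "norm (v x) \<le> C * (9 * (1 + norm eps2)) * norm (1 / ((1 + eps1)\<^sup>2 * (1 + eps2)))"
    if "v \<in> ?V eps1 eps2" "r0 < norm x" "eps1 \<noteq> -1" "norm eps1 \<le> 2" "eps2 \<noteq> -1" for eps1 eps2 v x
  proof -
    have "(1 + norm eps1)\<^sup>2 \<le> 3\<^sup>2" using that(4) by (intro power_mono) auto
    then have "C * ((1 + norm eps1)\<^sup>2 * (1 + norm eps2)) \<le> C * (9 * (1 + norm eps2))"
      using C(1) by (intro mult_left_mono mult_right_mono) auto
    from mult_right_mono[OF this norm_ge_zero] C(2)[OF that(1,2,3,5)] show ?thesis
      by (rule order_trans[rotated])
  qed
  have "resonance_order ?E (at (-1)) (\<lambda>eps1. ?V eps1 eps2) (\<lambda>eps1. 1 / (1 + eps1)\<^sup>2)"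
    if "eps2 \<noteq> -1" for eps2
    unfolding resonance_order_def
  proof (intro exI)
    show "\<forall>\<^sub>F eps1 in at (-1). \<forall>v\<in>?V eps1 eps2. \<forall>x\<in>?E.
        norm (v x) \<le> (C * (9 * (1 + norm eps2)) * norm (1 / (1 + eps2))) * norm (1 / (1 + eps1)\<^sup>2)"
      using eventually_near_minus_one
    proof (eventually_elim, intro ballI)
      fix eps1 v x assume e: "eps1 \<noteq> -1 \<and> norm eps1 \<le> 2" and v: "v \<in> ?V eps1 eps2" and x: "x \<in> ?E"
      have "norm (v x) \<le> C * (9 * (1 + norm eps2)) * norm (1 / ((1 + eps1)\<^sup>2 * (1 + eps2)))"
        using near[OF v _ _ _ that] e x by simp
      then show "norm (v x) \<le> (C * (9 * (1 + norm eps2)) * norm (1 / (1 + eps2))) * norm (1 / (1 + eps1)\<^sup>2)"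
        by (simp add: norm_divide norm_mult mult.commute)
    qed
  qed
  moreover have "resonance_order ?E (at (-1)) (\<lambda>eps2. ?V eps1 eps2) (\<lambda>eps2. 1 / (1 + eps2))"
    if "eps1 \<noteq> -1" for eps1
    unfolding resonance_order_def
  proof (intro exI)
    show "\<forall>\<^sub>F eps2 in at (-1). \<forall>v\<in>?V eps1 eps2. \<forall>x\<in>?E.
        norm (v x) \<le> (C * ((1 + norm eps1)\<^sup>2 * 3) * norm (1 / (1 + eps1)\<^sup>2)) * norm (1 / (1 + eps2))"
      using eventually_near_minus_one
    proof (eventually_elim, intro ballI)
      fix eps2 v x assume e: "eps2 \<noteq> -1 \<and> norm eps2 \<le> 2" and v: "v \<in> ?V eps1 eps2" and x: "x \<in> ?E"
      have "C * ((1 + norm eps1)\<^sup>2 * (1 + norm eps2)) \<le> C * ((1 + norm eps1)\<^sup>2 * 3)"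
        using C(1) e by (intro mult_left_mono) auto
      from mult_right_mono[OF this norm_ge_zero]
      have "norm (v x) \<le> C * ((1 + norm eps1)\<^sup>2 * 3) * norm (1 / ((1 + eps1)\<^sup>2 * (1 + eps2)))"
        by (rule order_trans[rotated]) (use C(2)[OF v _ that] x e in blast)
      then show "norm (v x) \<le> (C * ((1 + norm eps1)\<^sup>2 * 3) * norm (1 / (1 + eps1)\<^sup>2)) * norm (1 / (1 + eps2))"
        by (simp add: norm_divide norm_mult)
    qed
  qed
  moreover have "resonance_order ?E (at (-1) \<times>\<^sub>F at (-1)) (\<lambda>(eps1, eps2). ?V eps1 eps2)
      (\<lambda>(eps1, eps2). 1 / ((1 + eps1)\<^sup>2 * (1 + eps2)))"
    unfolding resonance_order_def
  proof (intro exI)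
    show "\<forall>\<^sub>F p in at (-1) \<times>\<^sub>F at (-1). \<forall>v\<in>case p of (eps1, eps2) \<Rightarrow> ?V eps1 eps2. \<forall>x\<in>?E.
        norm (v x) \<le> (C * (9 * 3)) * norm (case p of (eps1, eps2) \<Rightarrow> 1 / ((1 + eps1)\<^sup>2 * (1 + eps2)))"
      using eventually_prodI[OF eventually_near_minus_one eventually_near_minus_one]
    proof (eventually_elim, intro ballI)
      fix p :: "complex \<times> complex" and v x
      assume e: "(fst p \<noteq> -1 \<and> norm (fst p) \<le> 2) \<and> (snd p \<noteq> -1 \<and> norm (snd p) \<le> 2)"
        and v: "v \<in> (case p of (eps1, eps2) \<Rightarrow> ?V eps1 eps2)" and x: "x \<in> ?E"
      have "C * (9 * (1 + norm (snd p))) \<le> C * (9 * 3)"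
        using C(1) e by (intro mult_left_mono) auto
      from mult_right_mono[OF this norm_ge_zero]
      have "norm (v x) \<le> C * (9 * 3) * norm (1 / ((1 + fst p)\<^sup>2 * (1 + snd p)))"
      proof (rule order_trans[rotated])
        have "v \<in> ?V (fst p) (snd p)" using v by (simp add: case_prod_beta)
        then show "norm (v x) \<le> C * (9 * (1 + norm (snd p))) * norm (1 / ((1 + fst p)\<^sup>2 * (1 + snd p)))"
          using near x e by blast
      qed
      then show "norm (v x) \<le> (C * (9 * 3)) * norm (case p of (eps1, eps2) \<Rightarrow> 1 / ((1 + eps1)\<^sup>2 * (1 + eps2)))"
        by (simp add: case_prod_beta)
    qed
  qed
  ultimately show ?thesis using radiation by blast
qed

end
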